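(* (1) An inverse $\wedge$-semigroup $S$ (with zero) is pre-Boolean if and only if its semilattice of idempotents $E(S)$ is pre-Boolean. (2) Let $E$ be a meet semilattice with zero. Then $E$ is pre-Boolean if and only if every tight filter of $E$ is an ultrafilter. (3) Let $E$ be a $0$-disjunctive meet semilattice with zero. Then $E$ is pre-Boolean if and only if $E$ satisfies the trapping condition.
   Context: All inverse semigroups have a zero $0$, with order the natural partial order ($s\le t$ iff $s=te$ for some idempotent $e$). $S$ is an inverse $\wedge$-semigroup if each pair of elements has a meet. A meet semilattice with zero is regarded as an inverse $\wedge$-semigroup all of whose elements are idempotent. For a subset $X$, $X^{\downarrow}$ is the set of elements lying below some element of $X$; $x^\downarrow=\{x\}^\downarrow$. Elements $s,t$ are compatible if $s^{-1}t$ and $st^{-1}$ are idempotents; a subset is compatible if its elements are pairwise compatible. An inverse semigroup is distributive if every finite non-empty compatible subset has a join and left and right multiplication by any element distributes over such joins (the resulting joins existing). A distributive inverse semigroup is Boolean if its semilattice of idempotents is a generalized Boolean algebra (a distributive lattice with $0$, not necessarily with top, with relative complements: for all $a,b$ there is $b\setminus a$ with $a\vee b=a\vee(b\setminus a)$, $a\wedge(b\setminus a)=0$). For $a,a_1,\dots,a_m\in S$: $a\rightarrow\{a_1,\ldots,a_m\}$ iff for each non-zero $x\le a$ there is $i$ with $x\wedge a_i\ne0$. $\{a_1,\ldots,a_m\}\rightarrow\{b_1,\ldots,b_n\}$ iff $a_i\rightarrow\{b_1,\ldots,b_n\}$ for all $i$; $\leftrightarrow$ means $\rightarrow$ in both directions.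 A finite subset $A\subseteq a^\downarrow$ is a cover of $a$ if $a\rightarrow A$. Distributive completion. The relation $a\leftrightarrow b$ (i.e. $\{a\}\leftrightarrow\{b\}$) is a congruence on $S$, and $\mathbf{S}=S/\!\leftrightarrow$ is again an inverse $\wedge$-semigroup with zero; write $\mathbf{s}$ for the class of $s$. Let $\mathsf{FC}(\mathbf{S})$ be the set of finitely generated compatible order ideals $\{a_1,\ldots,a_m\}^{\downarrow}$ of $\mathbf{S}$ (with $m\ge 1$ and the $a_i$ pairwise compatible), under multiplication of subsets; it is a distributive inverse semigroup. Define $\{a_1,\ldots,a_m\}^\downarrow\equiv\{b_1,\ldots,b_n\}^\downarrow$ iff $\{a_1,\ldots,a_m\}\leftrightarrow\{b_1,\ldots,b_n\}$ in $\mathbf{S}$; this is a congruence. The distributive completion of $S$ is $\mathsf{D}(S)=\mathsf{FC}(\mathbf{S})/\!\equiv$, a distributive inverse $\wedge$-semigroup, with $\delta\colon S\to\mathsf{D}(S)$, $\delta(s)=[\mathbf{s}^\downarrow]$. It is universal for homomorphisms $\theta$ from $S$ to distributive inverse semigroups satisfying $\theta(s)=\bigvee\theta(A)$ for each finite cover $A$ of each $s\in S$. $S$ is pre-Boolean if $\mathsf{D}(S)$ is Boolean. A filter in $E$ is a non-empty upward closed subset not containing $0$ and closed under binary meets; an ultrafilter is a maximal filter. A filter $F$ is tight if for each $a\in F$ and each finite cover $\{a_1,\ldots,a_m\}$ of $a$ we have $a_i\in F$ for some $i$. $E$ is $0$-disjunctive if for all $e,f\in E$ with $0\ne e<f$ there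 exists $0\ne e'<f$ with $e\wedge e'=0$. For $y\in E$, $y^\perp=\{e\in E: e\wedge y=0\}$. A cover of a subset $A\subseteq E$ is a subset $Z\subseteq A$ such that for each non-zero $a\in A$ there is $z\in Z$ with $a\wedge z\ne 0$. $E$ satisfies the trapping condition if for all $0\ne y<x$ the set $x^\downarrow\cap y^\perp$ has a finite cover. *)

theory Defs
  imports "HOL-Algebra.Congruence"
begin

record 'a semigroup0 = "'a partial_object" +
  mult :: "'a \<Rightarrow> 'a \<Rightarrow> 'a" (infixl "\<cdot>\<index>" 70)
  zero :: 'a ("\<zero>\<index>")

subsection \<open>Inverse semigroups with zero\<close>

locale inverse_semigroup0 =
  fixes S :: "'a semigroup0" (structure)
  assumes mult_closed: "x \<in> carrier S \<Longrightarrow> y \<in> carrier S \<Longrightarrow> x \<cdot> y \<in> carrier S"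
    and mult_assoc: "x \<in> carrier S \<Longrightarrow> y \<in> carrier S \<Longrightarrow> z \<in> carrier S
          \<Longrightarrow> (x \<cdot> y) \<cdot> z = x \<cdot> (y \<cdot> z)"
    and ex1_inverse: "x \<in> carrier S
          \<Longrightarrow> \<exists>!y. y \<in> carrier S \<and> x \<cdot> y \<cdot> x = x \<and> y \<cdot> x \<cdot> y = y"
    and zero_closed: "\<zero> \<in> carrier S"
    and zero_mult: "x \<in> carrier S \<Longrightarrow> \<zero> \<cdot> x = \<zero>"
    and mult_zero: "x \<in> carrier S \<Longrightarrow> x \<cdot> \<zero> = \<zero>"

definition sinv :: "'a semigroup0 \<Rightarrow> 'a \<Rightarrow> 'a" where
  "sinv S x = (THE y. y \<in> carrier S \<and> x \<cdot>\<^bsub>S\<^esub> y \<cdot>\<^bsub>S\<^esub> x = x \<and> y \<cdot>\<^bsub>S\<^esub> x \<cdot>\<^bsub>S\<^esub> y = y)"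

definition idempotents :: "'a semigroup0 \<Rightarrow> 'a set" where
  "idempotents S = {e \<in> carrier S. e \<cdot>\<^bsub>S\<^esub> e = e}"

definition idempotent_semilattice :: "'a semigroup0 \<Rightarrow> 'a semigroup0" where
  "idempotent_semilattice S = S\<lparr>carrier := idempotents S\<rparr>"

definition nat_le :: "'a semigroup0 \<Rightarrow> 'a \<Rightarrow> 'a \<Rightarrow> bool" (infix "\<sqsubseteq>\<index>" 50) where
  "s \<sqsubseteq>\<^bsub>S\<^esub> t \<longleftrightarrow> (\<exists>e\<in>idempotents S. s = t \<cdot>\<^bsub>S\<^esub> e)"

definition is_meet :: "'a semigroup0 \<Rightarrow> 'a \<Rightarrow> 'a \<Rightarrow> 'a \<Rightarrow> bool" where
  "is_meet S x y m \<longleftrightarrow> m \<in> carrier S \<and> m \<sqsubseteq>\<^bsub>S\<^esub> x \<and> m \<sqsubseteq>\<^bsub>S\<^esub> y \<and>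
     (\<forall>z\<in>carrier S. z \<sqsubseteq>\<^bsub>S\<^esub> x \<and> z \<sqsubseteq>\<^bsub>S\<^esub> y \<longrightarrow> z \<sqsubseteq>\<^bsub>S\<^esub> m)"

definition meet :: "'a semigroup0 \<Rightarrow> 'a \<Rightarrow> 'a \<Rightarrow> 'a" (infixl "\<sqinter>\<index>" 70) where
  "x \<sqinter>\<^bsub>S\<^esub> y = (THE m. is_meet S x y m)"

definition is_join :: "'a semigroup0 \<Rightarrow> 'a set \<Rightarrow> 'a \<Rightarrow> bool" where
  "is_join S A j \<longleftrightarrow> j \<in> carrier S \<and> (\<forall>a\<in>A. a \<sqsubseteq>\<^bsub>S\<^esub> j) \<and>
     (\<forall>z\<in>carrier S. (\<forall>a\<in>A. a \<sqsubseteq>\<^bsub>S\<^esub> z) \<longrightarrow> j \<sqsubseteq>\<^bsub>S\<^esub> z)"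

definition join :: "'a semigroup0 \<Rightarrow> 'a \<Rightarrow> 'a \<Rightarrow> 'a" (infixl "\<squnion>\<index>" 65) where
  "x \<squnion>\<^bsub>S\<^esub> y = (THE j. is_join S {x, y} j)"

definition down :: "'a semigroup0 \<Rightarrow> 'a set \<Rightarrow> 'a set" where
  "down S A = {x \<in> carrier S. \<exists>a\<in>A. x \<sqsubseteq>\<^bsub>S\<^esub> a}"

definition compatible_set :: "'a semigroup0 \<Rightarrow> 'a set \<Rightarrow> bool" where
  "compatible_set S A \<longleftrightarrow> (\<forall>s\<in>A. \<forall>t\<in>A.
     sinv S s \<cdot>\<^bsub>S\<^esub> t \<in> idempotents S \<and> s \<cdot>\<^bsub>S\<^esub> sinv S t \<in> idempotents S)"

locale inverse_meet_semigroup = inverse_semigroup0 +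
  assumes ex_meet: "x \<in> carrier S \<Longrightarrow> y \<in> carrier S \<Longrightarrow> \<exists>m. is_meet S x y m"

locale meet_semilattice0 = inverse_meet_semigroup E for E :: "'a semigroup0" (structure) +
  assumes all_idempotent: "e \<in> carrier E \<Longrightarrow> e \<cdot> e = e"

subsection \<open>Distributive and Boolean inverse semigroups\<close>

locale distributive_inverse_semigroup = inverse_semigroup0 +
  assumes ex_join: "finite A \<Longrightarrow> A \<noteq> {} \<Longrightarrow> A \<subseteq> carrier S \<Longrightarrow> compatible_set S A
          \<Longrightarrow> \<exists>j. is_join S A j"
    and mult_join_left: "finite A \<Longrightarrow> A \<noteq> {} \<Longrightarrow> A \<subseteq> carrier S \<Longrightarrow> compatible_set S A
          \<Longrightarrow> is_join S A j \<Longrightarrow> s \<in> carrier S \<Longrightarrow> is_join S ((\<lambda>a. s \<cdot> a) ` A) (s \<cdot> j)"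
    and mult_join_right: "finite A \<Longrightarrow> A \<noteq> {} \<Longrightarrow> A \<subseteq> carrier S \<Longrightarrow> compatible_set S A
          \<Longrightarrow> is_join S A j \<Longrightarrow> s \<in> carrier S \<Longrightarrow> is_join S ((\<lambda>a. a \<cdot> s) ` A) (j \<cdot> s)"

locale generalized_boolean_algebra = meet_semilattice0 +
  assumes ex_binary_join: "a \<in> carrier E \<Longrightarrow> b \<in> carrier E \<Longrightarrow> \<exists>j. is_join E {a, b} j"
    and meet_join_distrib: "a \<in> carrier E \<Longrightarrow> b \<in> carrier E \<Longrightarrow> c \<in> carrier E
          \<Longrightarrow> a \<sqinter> (b \<squnion> c) = (a \<sqinter> b) \<squnion> (a \<sqinter> c)"
    and ex_relative_complement: "a \<in> carrier E \<Longrightarrow> b \<in> carrier E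
          \<Longrightarrow> \<exists>c\<in>carrier E. a \<squnion> b = a \<squnion> c \<and> a \<sqinter> c = \<zero>"

locale boolean_inverse_semigroup = distributive_inverse_semigroup +
  assumes boolean_idempotents: "generalized_boolean_algebra (idempotent_semilattice S)"

subsection \<open>The arrow relation and covers\<close>

definition arrow :: "'a semigroup0 \<Rightarrow> 'a \<Rightarrow> 'a set \<Rightarrow> bool" where
  "arrow S a B \<longleftrightarrow> (\<forall>x\<in>carrier S. x \<sqsubseteq>\<^bsub>S\<^esub> a \<and> x \<noteq> \<zero>\<^bsub>S\<^esub> \<longrightarrow> (\<exists>b\<in>B. x \<sqinter>\<^bsub>S\<^esub> b \<noteq> \<zero>\<^bsub>S\<^esub>))"

definition set_arrow :: "'a semigroup0 \<Rightarrow> 'a set \<Rightarrow> 'a set \<Rightarrow> bool" where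
  "set_arrow S A B \<longleftrightarrow> (\<forall>a\<in>A. arrow S a B)"

definition set_biarrow :: "'a semigroup0 \<Rightarrow> 'a set \<Rightarrow> 'a set \<Rightarrow> bool" where
  "set_biarrow S A B \<longleftrightarrow> set_arrow S A B \<and> set_arrow S B A"

definition finite_cover_of :: "'a semigroup0 \<Rightarrow> 'a set \<Rightarrow> 'a \<Rightarrow> bool" where
  "finite_cover_of S A a \<longleftrightarrow> finite A \<and> A \<subseteq> down S {a} \<and> arrow S a A"

subsection \<open>The distributive completion\<close>

text \<open>Quotient by a congruence \<open>R\<close>; the union in the product is then a single class.\<close>

definition quotient_semigroup :: "'a semigroup0 \<Rightarrow> 'a rel \<Rightarrow> 'a set semigroup0" where
  "quotient_semigroup S R = \<lparr>carrier = carrier S // R,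
     mult = (\<lambda>X Y. \<Union>x\<in>X. \<Union>y\<in>Y. R `` {x \<cdot>\<^bsub>S\<^esub> y}),
     zero = R `` {\<zero>\<^bsub>S\<^esub>}\<rparr>"

definition biarrow_rel :: "'a semigroup0 \<Rightarrow> 'a rel" where
  "biarrow_rel S = {(a, b). a \<in> carrier S \<and> b \<in> carrier S \<and> set_biarrow S {a} {b}}"

definition separated :: "'a semigroup0 \<Rightarrow> 'a set semigroup0" where
  "separated S = quotient_semigroup S (biarrow_rel S)"

definition generates :: "'a semigroup0 \<Rightarrow> 'a set \<Rightarrow> 'a set \<Rightarrow> bool" where
  "generates S A X \<longleftrightarrow> finite A \<and> A \<noteq> {} \<and> A \<subseteq> carrier S \<and> compatible_set S A \<and> X = down S A"

definition FC :: "'a semigroup0 \<Rightarrow> 'a set semigroup0" where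
  "FC S = \<lparr>carrier = {X. \<exists>A. generates S A X},
     mult = (\<lambda>X Y. {x \<cdot>\<^bsub>S\<^esub> y | x y. x \<in> X \<and> y \<in> Y}),
     zero = {\<zero>\<^bsub>S\<^esub>}\<rparr>"

definition FC_rel :: "'a semigroup0 \<Rightarrow> 'a set rel" where
  "FC_rel S = {(X, Y). \<exists>A B. generates S A X \<and> generates S B Y \<and> set_biarrow S A B}"

definition distributive_completion :: "'a semigroup0 \<Rightarrow> 'a set set set semigroup0" where
  "distributive_completion S = quotient_semigroup (FC (separated S)) (FC_rel (separated S))"

definition pre_boolean :: "'a semigroup0 \<Rightarrow> bool" where
  "pre_boolean S \<longleftrightarrow> boolean_inverse_semigroup (distributive_completion S)"

subsection \<open>Filters in meet semilattices with zero\<close>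

definition meet_filter :: "'a semigroup0 \<Rightarrow> 'a set \<Rightarrow> bool" where
  "meet_filter E F \<longleftrightarrow> F \<subseteq> carrier E \<and> F \<noteq> {} \<and> \<zero>\<^bsub>E\<^esub> \<notin> F \<and>
     (\<forall>x\<in>F. \<forall>y\<in>carrier E. x \<sqsubseteq>\<^bsub>E\<^esub> y \<longrightarrow> y \<in> F) \<and>
     (\<forall>x\<in>F. \<forall>y\<in>F. x \<sqinter>\<^bsub>E\<^esub> y \<in> F)"

definition meet_ultrafilter :: "'a semigroup0 \<Rightarrow> 'a set \<Rightarrow> bool" where
  "meet_ultrafilter E F \<longleftrightarrow> meet_filter E F \<and> (\<forall>G. meet_filter E G \<and> F \<subseteq> G \<longrightarrow> G = F)"

definition tight_filter :: "'a semigroup0 \<Rightarrow> 'a set \<Rightarrow> bool" where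
  "tight_filter E F \<longleftrightarrow> meet_filter E F \<and>
     (\<forall>a\<in>F. \<forall>A. finite_cover_of E A a \<longrightarrow> (\<exists>b\<in>A. b \<in> F))"

subsection \<open>0-disjunctivity and the trapping condition\<close>

definition zero_disjunctive :: "'a semigroup0 \<Rightarrow> bool" where
  "zero_disjunctive E \<longleftrightarrow> (\<forall>e\<in>carrier E. \<forall>f\<in>carrier E.
     e \<noteq> \<zero>\<^bsub>E\<^esub> \<and> e \<sqsubseteq>\<^bsub>E\<^esub> f \<and> e \<noteq> f \<longrightarrow>
     (\<exists>e'\<in>carrier E. e' \<noteq> \<zero>\<^bsub>E\<^esub> \<and> e' \<sqsubseteq>\<^bsub>E\<^esub> f \<and> e' \<noteq> f \<and> e \<sqinter>\<^bsub>E\<^esub> e' = \<zero>\<^bsub>E\<^esub>))"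

definition perp :: "'a semigroup0 \<Rightarrow> 'a \<Rightarrow> 'a set" where
  "perp E y = {e \<in> carrier E. e \<sqinter>\<^bsub>E\<^esub> y = \<zero>\<^bsub>E\<^esub>}"

definition cover_of_subset :: "'a semigroup0 \<Rightarrow> 'a set \<Rightarrow> 'a set \<Rightarrow> bool" where
  "cover_of_subset E Z A \<longleftrightarrow> Z \<subseteq> A \<and>
     (\<forall>a\<in>A. a \<noteq> \<zero>\<^bsub>E\<^esub> \<longrightarrow> (\<exists>z\<in>Z. a \<sqinter>\<^bsub>E\<^esub> z \<noteq> \<zero>\<^bsub>E\<^esub>))"

definition trapping :: "'a semigroup0 \<Rightarrow> bool" where
  "trapping E \<longleftrightarrow> (\<forall>x\<in>carrier E. \<forall>y\<in>carrier E.
     y \<noteq> \<zero>\<^bsub>E\<^esub> \<and> y \<sqsubseteq>\<^bsub>E\<^esub> x \<and> y \<noteq> x \<longrightarrow>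
     (\<exists>Z. finite Z \<and> cover_of_subset E Z (down E {x} \<inter> perp E y)))"

end

(*
Proof idea. A generalized Boolean algebra is a distributive lattice with relative complements, so for
the distributive inverse semigroup D(S) being Boolean only means that relative complements of
idempotents exist. The idempotents of D(S) are the classes of finitely generated ideals of idempotents
of S. Read back in S, a complement of e in f is a finite set C of idempotents orthogonal to e such
that f -> {e} Un C. This condition only mentions E(S), which gives (1).

For (2), a tight filter containing f must contain e or a member of C, so no filter properly extends it.
Conversely, if no such C exists for e and f, Zorn's lemma gives a filter containing f and maximal among
those avoiding the ideal of all x with x -> {e} Un C for some C; it is tight, and adjoining e enlarges it.
For (3), C is a finite cover of the elements below f orthogonal to e meet f.
*)
theory Submission
  imports Defs
begin

text \<open>The completion is a quotient of a quotient, and the criterion has to survive both. The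
  obstacle is joins. The join of finitely many classes of ideals should be the class of their union,
  but that union lies in \<open>FC\<close> only if it is compatible, whereas what is given is
  compatibility of the classes. The way back is that an ideal whose class is idempotent consists of
  idempotents. This rests on a property of the separated quotient: once
  \<open>a \<leftrightarrow> b\<close> forces \<open>a = b\<close>, an element covered by
  idempotents is itself idempotent. Complements of arbitrary finitely generated ideals reduce to
  complements of single idempotents, because a piece already orthogonal to some generators can be
  split again by the next one. In the filter argument the ideal to be avoided has to absorb every
  element that it covers finitely; downward closure alone would not turn maximality into
  tightness.\<close>

section \<open>Inverse semigroups with zero\<close>

text \<open>Regularity together with commuting idempotents characterizes inverse semigroups. Both
  quotients, the semigroup of ideals and the semilattice of idempotents are treated through this
  criterion, which spares a direct proof that inverses are unique.\<close>

lemma inverse_semigroup0I: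
  fixes S :: "'a semigroup0" (structure)
  assumes closed: "\<And>x y. x \<in> carrier S \<Longrightarrow> y \<in> carrier S \<Longrightarrow> x \<cdot> y \<in> carrier S"
    and assoc: "\<And>x y z. x \<in> carrier S \<Longrightarrow> y \<in> carrier S \<Longrightarrow> z \<in> carrier S
          \<Longrightarrow> (x \<cdot> y) \<cdot> z = x \<cdot> (y \<cdot> z)"
    and regular: "\<And>x. x \<in> carrier S \<Longrightarrow> \<exists>y\<in>carrier S. x \<cdot> y \<cdot> x = x"
    and idem_comm: "\<And>e f. e \<in> idempotents S \<Longrightarrow> f \<in> idempotents S \<Longrightarrow> e \<cdot> f = f \<cdot> e"
    and zero: "\<zero> \<in> carrier S" "\<And>x. x \<in> carrier S \<Longrightarrow> \<zero> \<cdot> x = \<zero>"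
      "\<And>x. x \<in> carrier S \<Longrightarrow> x \<cdot> \<zero> = \<zero>"
  shows "inverse_semigroup0 S"
proof
  have cancel: "u \<cdot> (v \<cdot> u) = u" "\<And>w. w \<in> carrier S \<Longrightarrow> u \<cdot> (v \<cdot> (u \<cdot> w)) = u \<cdot> w"
    if "u \<in> carrier S" "v \<in> carrier S" "u \<cdot> v \<cdot> u = u" for u v
    using that by (simp_all flip: assoc add: closed)
  fix x assume x: "x \<in> carrier S"
  show "\<exists>!y. y \<in> carrier S \<and> x \<cdot> y \<cdot> x = x \<and> y \<cdot> x \<cdot> y = y"
  proof (rule ex_ex1I)
    obtain y where y: "y \<in> carrier S" "x \<cdot> y \<cdot> x = x"
      using regular x by blast
    note simps = cancel[OF x y] assoc closed x y(1)
    show "\<exists>y. y \<in> carrier S \<and> x \<cdot> y \<cdot> x = x \<and> y \<cdot> x \<cdot> y = y"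
      by (rule exI[of _ "y \<cdot> x \<cdot> y"]) (simp add: simps)
  next
    fix y z
    assume "y \<in> carrier S \<and> x \<cdot> y \<cdot> x = x \<and> y \<cdot> x \<cdot> y = y"
      and "z \<in> carrier S \<and> x \<cdot> z \<cdot> x = x \<and> z \<cdot> x \<cdot> z = z"
    then have y: "y \<in> carrier S" "x \<cdot> y \<cdot> x = x" "y \<cdot> x \<cdot> y = y"
      and z: "z \<in> carrier S" "x \<cdot> z \<cdot> x = x" "z \<cdot> x \<cdot> z = z" by auto
    note simps = cancel[OF x y(1,2)] cancel[OF y(1) x y(3)] cancel[OF x z(1,2)]
      cancel[OF z(1) x z(3)] assoc closed x y(1) z(1)
    have idem: "y \<cdot> x \<in> idempotents S" "z \<cdot> x \<in> idempotents S"
        "x \<cdot> y \<in> idempotents S" "x \<cdot> z \<in> idempotents S"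
      by (simp_all add: idempotents_def simps)
    \<comment> \<open>Both inverses reduce to \<open>y \<cdot> (x \<cdot> z)\<close>: the first by
      exchanging the idempotents \<open>x \<cdot> z\<close> and \<open>x \<cdot> y\<close>, the
      second by exchanging \<open>z \<cdot> x\<close> and \<open>y \<cdot> x\<close>.\<close>
    have "y = y \<cdot> ((x \<cdot> z) \<cdot> (x \<cdot> y))"
      by (simp add: simps)
    also have "\<dots> = y \<cdot> ((x \<cdot> y) \<cdot> (x \<cdot> z))"
      by (simp only: idem_comm[OF idem(4,3)])
    also have "\<dots> = y \<cdot> (x \<cdot> z)"
      by (simp add: simps)
    finally have 1: "y = y \<cdot> (x \<cdot> z)" .
    have "z = ((z \<cdot> x) \<cdot> (y \<cdot> x)) \<cdot> z"
      by (simp add: simps)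
    also have "\<dots> = ((y \<cdot> x) \<cdot> (z \<cdot> x)) \<cdot> z"
      by (simp only: idem_comm[OF idem(2,1)])
    also have "\<dots> = y \<cdot> (x \<cdot> z)"
      by (simp add: simps)
    finally show "y = z" using 1 by simp
  qed
qed (fact+)

context inverse_semigroup0
begin

declare mult_closed [simp] zero_closed [simp] zero_mult [simp] mult_zero [simp]

section \<open>Inverses and the commutation of idempotents\<close>

lemma sinv_unique:
  assumes "x \<in> carrier S" "y \<in> carrier S" "x \<cdot> y \<cdot> x = x" "y \<cdot> x \<cdot> y = y"
  shows "sinv S x = y"
  unfolding sinv_def using ex1_inverse[of x] assms by (intro the1_equality) auto

lemma sinv_closed [simp]: "x \<in> carrier S \<Longrightarrow> sinv S x \<in> carrier S"
  and mult_sinv_mult: "x \<in> carrier S \<Longrightarrow> x \<cdot> sinv S x \<cdot> x = x"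
  and sinv_mult_sinv: "x \<in> carrier S \<Longrightarrow> sinv S x \<cdot> x \<cdot> sinv S x = sinv S x"
  using theI'[OF ex1_inverse[of x]] unfolding sinv_def by auto

lemma sinv_sinv [simp]: "x \<in> carrier S \<Longrightarrow> sinv S (sinv S x) = x"
  by (rule sinv_unique) (auto simp: mult_sinv_mult sinv_mult_sinv)

lemma inv_cancel [simp]:
  assumes "x \<in> carrier S"
  shows "x \<cdot> (sinv S x \<cdot> x) = x" "sinv S x \<cdot> (x \<cdot> sinv S x) = sinv S x"
  using assms by (simp_all flip: mult_assoc add: mult_sinv_mult sinv_mult_sinv)

lemma inv_cancel_left [simp]:
  assumes "x \<in> carrier S" "z \<in> carrier S"
  shows "x \<cdot> (sinv S x \<cdot> (x \<cdot> z)) = x \<cdot> z"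
    "sinv S x \<cdot> (x \<cdot> (sinv S x \<cdot> z)) = sinv S x \<cdot> z"
  using assms by (simp_all flip: mult_assoc add: mult_sinv_mult sinv_mult_sinv)

lemma idemI: "e \<in> carrier S \<Longrightarrow> e \<cdot> e = e \<Longrightarrow> e \<in> idempotents S"
  by (simp add: idempotents_def)

lemma idem_closed: "e \<in> idempotents S \<Longrightarrow> e \<in> carrier S"
  by (simp add: idempotents_def)

lemma idem_idem [simp]: "e \<in> idempotents S \<Longrightarrow> e \<cdot> e = e"
  by (simp add: idempotents_def)

lemma idem_left [simp]: "e \<in> idempotents S \<Longrightarrow> z \<in> carrier S \<Longrightarrow> e \<cdot> (e \<cdot> z) = e \<cdot> z"
  by (metis idem_closed idem_idem mult_assoc)

lemma sinv_idem [simp]: "e \<in> idempotents S \<Longrightarrow> sinv S e = e"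
  by (rule sinv_unique) (auto simp: idem_closed)

lemma zero_idem [simp]: "\<zero> \<in> idempotents S"
  by (rule idemI) auto

text \<open>With \<open>x\<close> the inverse of \<open>e \<cdot> f\<close>, the element
  \<open>f \<cdot> (x \<cdot> e)\<close> is also an inverse of it, so the two agree. The latter
  squares to itself, hence \<open>x\<close> is idempotent and equals its own inverse
  \<open>e \<cdot> f\<close>.\<close>

lemma idem_mult [simp]:
  assumes "e \<in> idempotents S" "f \<in> idempotents S"
  shows "e \<cdot> f \<in> idempotents S"
proof -
  have c: "e \<in> carrier S" "f \<in> carrier S" using assms by (auto simp: idem_closed)
  define x where "x = sinv S (e \<cdot> f)"
  have xc: "x \<in> carrier S" using c by (simp add: x_def)
  have x1: "e \<cdot> (f \<cdot> (x \<cdot> (e \<cdot> f))) = e \<cdot> f"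
    and x2: "x \<cdot> (e \<cdot> (f \<cdot> x)) = x"
    using mult_sinv_mult[of "e \<cdot> f"] sinv_mult_sinv[of "e \<cdot> f"] c xc
    by (simp_all add: x_def[symmetric] mult_assoc)
  have x2': "x \<cdot> (e \<cdot> (f \<cdot> (x \<cdot> z))) = x \<cdot> z" if "z \<in> carrier S" for z
    using sinv_mult_sinv[of "e \<cdot> f"] that xc c
    by (simp_all flip: mult_assoc add: x_def[symmetric])
  have "sinv S (e \<cdot> f) = f \<cdot> (x \<cdot> e)"
    by (rule sinv_unique) (use assms c xc x1 x2' in \<open>simp_all add: mult_assoc\<close>)
  then have x: "x = f \<cdot> (x \<cdot> e)" unfolding x_def[symmetric] .
  have "(f \<cdot> (x \<cdot> e)) \<cdot> (f \<cdot> (x \<cdot> e)) = f \<cdot> (x \<cdot> e)"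
    using assms c xc x2' by (simp add: mult_assoc)
  then have "x \<in> idempotents S"
    unfolding x[symmetric] using xc by (rule idemI[rotated])
  moreover have "e \<cdot> f = sinv S x" using c by (simp add: x_def)
  ultimately show ?thesis by simp
qed

text \<open>Both products are idempotent, so \<open>f \<cdot> e\<close> is an inverse of
  \<open>e \<cdot> f\<close>; but an idempotent is its own inverse.\<close>

lemma idem_commute:
  assumes "e \<in> idempotents S" "f \<in> idempotents S"
  shows "e \<cdot> f = f \<cdot> e"
proof -
  have c: "e \<in> carrier S" "f \<in> carrier S" using assms by (auto simp: idem_closed)
  have "e \<cdot> (f \<cdot> (e \<cdot> f)) = e \<cdot> f" "f \<cdot> (e \<cdot> (f \<cdot> e)) = f \<cdot> e"
    using idem_idem[OF idem_mult[OF assms]] idem_idem[OF idem_mult[OF assms(2,1)]] c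
    by (simp_all add: mult_assoc)
  then have "sinv S (e \<cdot> f) = f \<cdot> e"
    by (intro sinv_unique) (use assms c in \<open>simp_all add: mult_assoc\<close>)
  then show ?thesis using assms by simp
qed

lemma idem_left_commute:
  assumes "e \<in> idempotents S" "f \<in> idempotents S" "z \<in> carrier S"
  shows "e \<cdot> (f \<cdot> z) = f \<cdot> (e \<cdot> z)"
  by (metis assms idem_commute mult_assoc idem_closed)

lemma sinv_mult_idem [simp]: "x \<in> carrier S \<Longrightarrow> sinv S x \<cdot> x \<in> idempotents S"
  and mult_sinv_idem [simp]: "x \<in> carrier S \<Longrightarrow> x \<cdot> sinv S x \<in> idempotents S"
  by (auto intro: idemI simp: mult_assoc)

lemma sinv_mult:
  assumes "x \<in> carrier S" "y \<in> carrier S"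
  shows "sinv S (x \<cdot> y) = sinv S y \<cdot> sinv S x"
proof (rule sinv_unique)
  have comm: "(sinv S x \<cdot> x) \<cdot> (y \<cdot> sinv S y) = (y \<cdot> sinv S y) \<cdot> (sinv S x \<cdot> x)"
    using assms by (intro idem_commute) auto
  have "x \<cdot> y \<cdot> (sinv S y \<cdot> sinv S x) \<cdot> (x \<cdot> y)
      = x \<cdot> (((y \<cdot> sinv S y) \<cdot> (sinv S x \<cdot> x)) \<cdot> y)"
    using assms by (simp add: mult_assoc)
  also have "\<dots> = x \<cdot> y"
    unfolding comm[symmetric] using assms by (simp add: mult_assoc)
  finally show "x \<cdot> y \<cdot> (sinv S y \<cdot> sinv S x) \<cdot> (x \<cdot> y) = x \<cdot> y" .
  have "sinv S y \<cdot> sinv S x \<cdot> (x \<cdot> y) \<cdot> (sinv S y \<cdot> sinv S x)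
      = sinv S y \<cdot> (((sinv S x \<cdot> x) \<cdot> (y \<cdot> sinv S y)) \<cdot> sinv S x)"
    using assms by (simp add: mult_assoc)
  also have "\<dots> = sinv S y \<cdot> sinv S x"
    unfolding comm using assms by (simp add: mult_assoc)
  finally show "sinv S y \<cdot> sinv S x \<cdot> (x \<cdot> y) \<cdot> (sinv S y \<cdot> sinv S x) = sinv S y \<cdot> sinv S x" .
qed (use assms in auto)

text \<open>The outer factors meet in the middle of the square as an idempotent
  \<open>x x^-1\<close> or \<open>x^-1 x\<close>, which commutes past \<open>e\<close> and is
  absorbed. Conjugation is how idempotents are moved across an element.\<close>

lemma conj_idem [simp]:
  assumes "e \<in> idempotents S" "x \<in> carrier S"
  shows "sinv S x \<cdot> (e \<cdot> x) \<in> idempotents S" "x \<cdot> (e \<cdot> sinv S x) \<in> idempotents S"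
proof -
  have c: "e \<in> carrier S" using assms by (auto simp: idem_closed)
  have "e \<cdot> (x \<cdot> (sinv S x \<cdot> (e \<cdot> x))) = e \<cdot> x"
    using assms c idem_left_commute[of e "x \<cdot> sinv S x" "e \<cdot> x"]
      idem_left_commute[of e "x \<cdot> sinv S x" x]
    by (simp add: mult_assoc)
  then show "sinv S x \<cdot> (e \<cdot> x) \<in> idempotents S"
    using assms c by (intro idemI) (simp_all add: mult_assoc)
  have "e \<cdot> (sinv S x \<cdot> (x \<cdot> (e \<cdot> sinv S x))) = e \<cdot> sinv S x"
    using assms c idem_left_commute[of e "sinv S x \<cdot> x" "e \<cdot> sinv S x"]
      idem_left_commute[of e "sinv S x \<cdot> x" "sinv S x"]
    by (simp add: mult_assoc)
  then show "x \<cdot> (e \<cdot> sinv S x) \<in> idempotents S"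
    using assms c by (intro idemI) (simp_all add: mult_assoc)
qed

section \<open>The natural partial order\<close>

lemma le_rightI: "e \<in> idempotents S \<Longrightarrow> s = t \<cdot> e \<Longrightarrow> s \<sqsubseteq> t"
  by (auto simp: nat_le_def)

text \<open>The order is defined by restriction on the right; conjugation rewrites
  \<open>e t\<close> as \<open>t (t^-1 e t)\<close>, so restriction on the left yields the same
  order.\<close>

lemma le_leftI:
  assumes "t \<in> carrier S" "e \<in> idempotents S" "s = e \<cdot> t"
  shows "s \<sqsubseteq> t"
proof (rule le_rightI)
  show "sinv S t \<cdot> (e \<cdot> t) \<in> idempotents S" using assms by simp
  show "s = t \<cdot> (sinv S t \<cdot> (e \<cdot> t))"
    using assms idem_left_commute[of e "t \<cdot> sinv S t" t]
    by (simp add: mult_assoc idem_closed)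
qed

lemma le_iff_right:
  assumes "s \<in> carrier S" "t \<in> carrier S"
  shows "s \<sqsubseteq> t \<longleftrightarrow> s = t \<cdot> (sinv S s \<cdot> s)"
proof
  assume "s \<sqsubseteq> t"
  then obtain e where e: "e \<in> idempotents S" "s = t \<cdot> e" by (auto simp: nat_le_def)
  show "s = t \<cdot> (sinv S s \<cdot> s)"
    using assms e idem_left_commute[of e "sinv S t \<cdot> t" e]
    by (simp add: idem_closed sinv_mult mult_assoc)
qed (rule le_rightI[OF sinv_mult_idem[OF assms(1)]])

lemma le_iff_left:
  assumes "s \<in> carrier S" "t \<in> carrier S"
  shows "s \<sqsubseteq> t \<longleftrightarrow> s = (s \<cdot> sinv S s) \<cdot> t"
proof
  assume "s \<sqsubseteq> t"
  then obtain e where e: "e \<in> idempotents S" "s = t \<cdot> e" by (auto simp: nat_le_def)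
  show "s = (s \<cdot> sinv S s) \<cdot> t"
    using assms e idem_commute[of e "sinv S t \<cdot> t"]
    by (simp add: idem_closed sinv_mult mult_assoc)
qed (rule le_leftI[OF assms(2) mult_sinv_idem[OF assms(1)]])

lemma le_refl [simp]: "s \<in> carrier S \<Longrightarrow> s \<sqsubseteq> s"
  by (simp add: le_iff_right)

lemma le_trans:
  assumes "s \<sqsubseteq> t" "t \<sqsubseteq> u" "u \<in> carrier S"
  shows "s \<sqsubseteq> u"
proof -
  obtain e f where "e \<in> idempotents S" "s = t \<cdot> e" "f \<in> idempotents S" "t = u \<cdot> f"
    using assms by (auto simp: nat_le_def)
  then show ?thesis
    using assms by (intro le_rightI[of "f \<cdot> e"]) (auto simp: mult_assoc idem_closed)
qed

text \<open>The product has the form \<open>t (e v) f\<close>, and the idempotent caught in the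
  middle moves to the right of \<open>v\<close> because \<open>e v\<close> is itself a restriction
  of \<open>v\<close>.\<close>

lemma le_mult:
  assumes "s \<sqsubseteq> t" "u \<sqsubseteq> v" "t \<in> carrier S" "v \<in> carrier S"
  shows "s \<cdot> u \<sqsubseteq> t \<cdot> v"
proof -
  obtain e f where e: "e \<in> idempotents S" "s = t \<cdot> e" and f: "f \<in> idempotents S" "u = v \<cdot> f"
    using assms by (auto simp: nat_le_def)
  have "e \<cdot> v \<sqsubseteq> v" using e assms by (intro le_leftI) auto
  then obtain g where g: "g \<in> idempotents S" "e \<cdot> v = v \<cdot> g" by (auto simp: nat_le_def)
  have "s \<cdot> u = t \<cdot> ((e \<cdot> v) \<cdot> f)"
    using e f assms by (simp add: mult_assoc idem_closed)
  also have "\<dots> = t \<cdot> v \<cdot> (g \<cdot> f)"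
    using e f g assms by (simp add: mult_assoc idem_closed)
  finally show ?thesis using f g by (intro le_rightI[of "g \<cdot> f"]) auto
qed

lemma le_sinv:
  assumes "s \<sqsubseteq> t" "t \<in> carrier S"
  shows "sinv S s \<sqsubseteq> sinv S t"
proof -
  obtain e where "e \<in> idempotents S" "s = t \<cdot> e" using assms by (auto simp: nat_le_def)
  then show ?thesis using assms
    by (intro le_leftI[of _ e]) (auto simp: sinv_mult idem_closed)
qed

lemma le_closed: "s \<sqsubseteq> t \<Longrightarrow> t \<in> carrier S \<Longrightarrow> s \<in> carrier S"
  by (auto simp: nat_le_def idem_closed)

text \<open>The idempotents \<open>s^-1 s\<close> and \<open>t^-1 t\<close> lie below each other and
  commute, hence coincide; then \<open>s\<close> is the restriction of \<open>t\<close> to its own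
  domain.\<close>

lemma le_antisym:
  assumes "s \<sqsubseteq> t" "t \<sqsubseteq> s" "s \<in> carrier S" "t \<in> carrier S"
  shows "s = t"
proof -
  have "sinv S s \<cdot> s \<sqsubseteq> sinv S t \<cdot> t" "sinv S t \<cdot> t \<sqsubseteq> sinv S s \<cdot> s"
    using assms by (auto intro!: le_mult le_sinv)
  then have "sinv S s \<cdot> s = (sinv S t \<cdot> t) \<cdot> (sinv S s \<cdot> s)"
      "sinv S t \<cdot> t = (sinv S s \<cdot> s) \<cdot> (sinv S t \<cdot> t)"
    using assms le_iff_right[of "sinv S s \<cdot> s" "sinv S t \<cdot> t"]
      le_iff_right[of "sinv S t \<cdot> t" "sinv S s \<cdot> s"] by simp_all
  then have eq: "sinv S s \<cdot> s = sinv S t \<cdot> t"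
    using idem_commute[of "sinv S s \<cdot> s" "sinv S t \<cdot> t"] assms by (metis sinv_mult_idem)
  have "s = t \<cdot> (sinv S s \<cdot> s)" using assms le_iff_right by blast
  also have "\<dots> = t" unfolding eq using assms by simp
  finally show ?thesis .
qed

lemma le_idem:
  assumes "s \<sqsubseteq> e" "e \<in> idempotents S"
  shows "s \<in> idempotents S"
  using assms by (auto simp: nat_le_def)

lemma le_zero [simp]: "x \<sqsubseteq> \<zero> \<longleftrightarrow> x = \<zero>"
  by (auto simp: nat_le_def idem_closed intro: zero_idem)

lemma idem_le_mult:
  assumes "z \<sqsubseteq> e" "z \<sqsubseteq> f" "e \<in> idempotents S" "f \<in> idempotents S"
  shows "z \<sqsubseteq> e \<cdot> f"
  using le_mult[OF assms(1,2)] le_idem[OF assms(1,3)] assms by (simp add: idem_closed)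

lemma idem_mult_le:
  assumes "e \<in> idempotents S" "f \<in> idempotents S"
  shows "e \<cdot> f \<sqsubseteq> e" "e \<cdot> f \<sqsubseteq> f"
  using assms by (auto intro: le_rightI le_leftI simp: idem_closed)

lemma idem_le_sinv_mult:
  assumes "e \<sqsubseteq> t" "e \<in> idempotents S" "t \<in> carrier S"
  shows "e \<sqsubseteq> sinv S t \<cdot> t"
  using le_mult[OF le_sinv[OF assms(1)] assms(1)] assms by simp

lemma sinv_mult_of_le:
  assumes "s \<sqsubseteq> t" "t \<in> carrier S"
  shows "sinv S t \<cdot> s = sinv S s \<cdot> s"
proof -
  have c: "s \<in> carrier S" using le_closed assms by blast
  have "sinv S s \<cdot> s \<sqsubseteq> sinv S t \<cdot> t"
    using assms c by (auto intro!: le_mult le_sinv)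
  then have "sinv S s \<cdot> s = (sinv S t \<cdot> t) \<cdot> (sinv S s \<cdot> s)"
    using assms c le_iff_right[of "sinv S s \<cdot> s" "sinv S t \<cdot> t"] by simp
  also have "\<dots> = sinv S t \<cdot> (t \<cdot> (sinv S s \<cdot> s))" using assms c by (simp add: mult_assoc)
  also have "\<dots> = sinv S t \<cdot> s" using assms c le_iff_right[of s t] by metis
  finally show ?thesis ..
qed

lemma join_unique:
  assumes "is_join S A j" "is_join S A k"
  shows "j = k"
  using assms by (intro le_antisym) (auto simp: is_join_def)

text \<open>An element below \<open>a c\<close> has the form \<open>g a c\<close> with
  \<open>g\<close> idempotent, so cancelling \<open>c\<close> and multiplying by it again loses
  nothing. This makes pulling elements back along a multiplication reversible.\<close>

lemma le_mult_absorb_right: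
  assumes "u \<sqsubseteq> a \<cdot> c" "a \<in> carrier S" "c \<in> carrier S"
  shows "u \<cdot> (sinv S c \<cdot> c) = u"
proof -
  have u: "u \<in> carrier S" using assms le_closed by auto
  then have eq: "u = (u \<cdot> sinv S u) \<cdot> (a \<cdot> c)" using le_iff_left[of u "a \<cdot> c"] assms by simp
  show ?thesis
    by (subst (1 2) eq) (use u assms in \<open>simp add: mult_assoc\<close>)
qed

lemma le_mult_absorb_left:
  assumes "u \<sqsubseteq> c \<cdot> a" "a \<in> carrier S" "c \<in> carrier S"
  shows "c \<cdot> (sinv S c \<cdot> u) = u"
proof -
  have u: "u \<in> carrier S" using assms le_closed by auto
  then have eq: "u = (c \<cdot> a) \<cdot> (sinv S u \<cdot> u)" using le_iff_right[of u "c \<cdot> a"] assms by simp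
  show ?thesis
    by (subst (1 2) eq) (use u assms in \<open>simp add: mult_assoc\<close>)
qed

lemma idem_absorb_le:
  assumes "e \<in> idempotents S" "x \<in> carrier S"
  shows "e \<cdot> x \<sqsubseteq> x" "x \<cdot> e \<sqsubseteq> x"
  using assms by (auto intro: le_rightI le_leftI)

lemma down_subset_carrier [simp]: "down S A \<subseteq> carrier S"
  by (auto simp: down_def)

lemma subset_down: "A \<subseteq> carrier S \<Longrightarrow> A \<subseteq> down S A"
  using le_refl unfolding down_def by blast

end

section \<open>Meets and the arrow relation\<close>

context inverse_meet_semigroup
begin

lemma is_meet_meet:
  assumes "x \<in> carrier S" "y \<in> carrier S"
  shows "is_meet S x y (x \<sqinter> y)"
proof -
  obtain m where m: "is_meet S x y m" using ex_meet assms by blast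
  have "n = m" if "is_meet S x y n" for n
    using m that by (intro le_antisym) (auto simp: is_meet_def)
  with m show ?thesis unfolding meet_def by (rule theI)
qed

lemma meet_eqI:
  assumes "is_meet S x y m" "x \<in> carrier S" "y \<in> carrier S"
  shows "x \<sqinter> y = m"
  using is_meet_meet[OF assms(2,3)] assms(1) by (intro le_antisym) (auto simp: is_meet_def)

lemma
  assumes "x \<in> carrier S" "y \<in> carrier S"
  shows meet_closed [simp]: "x \<sqinter> y \<in> carrier S"
    and meet_le1: "x \<sqinter> y \<sqsubseteq> x" and meet_le2: "x \<sqinter> y \<sqsubseteq> y"
    and meet_greatest: "z \<sqsubseteq> x \<Longrightarrow> z \<sqsubseteq> y \<Longrightarrow> z \<sqsubseteq> x \<sqinter> y"
  using is_meet_meet[OF assms] assms le_closed by (auto simp: is_meet_def)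

lemma meet_nonzero_iff:
  assumes "x \<in> carrier S" "y \<in> carrier S"
  shows "x \<sqinter> y \<noteq> \<zero> \<longleftrightarrow> (\<exists>w. w \<noteq> \<zero> \<and> w \<sqsubseteq> x \<and> w \<sqsubseteq> y)"
  using meet_le1[OF assms] meet_le2[OF assms] meet_greatest[OF assms] le_zero by metis

text \<open>A meet is non-zero as soon as there is some non-zero common lower bound. In this form
  arrows are composed by passing to ever smaller non-zero elements, without computing meets.\<close>

lemma arrow_iff:
  assumes "a \<in> carrier S" "B \<subseteq> carrier S"
  shows "arrow S a B \<longleftrightarrow>
    (\<forall>x. x \<sqsubseteq> a \<and> x \<noteq> \<zero> \<longrightarrow> (\<exists>b\<in>B. \<exists>w. w \<noteq> \<zero> \<and> w \<sqsubseteq> x \<and> w \<sqsubseteq> b))"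
proof -
  have "x \<sqinter> b \<noteq> \<zero> \<longleftrightarrow> (\<exists>w. w \<noteq> \<zero> \<and> w \<sqsubseteq> x \<and> w \<sqsubseteq> b)"
    if "x \<sqsubseteq> a" "b \<in> B" for x b
    using that assms le_closed[of x a] by (intro meet_nonzero_iff) auto
  then show ?thesis using le_closed[of _ a] assms unfolding arrow_def by blast
qed

lemma arrowI:
  assumes "a \<in> carrier S" "B \<subseteq> carrier S"
    and "\<And>x. x \<in> carrier S \<Longrightarrow> x \<sqsubseteq> a \<Longrightarrow> x \<noteq> \<zero> \<Longrightarrow> \<exists>b\<in>B. \<exists>w. w \<noteq> \<zero> \<and> w \<sqsubseteq> x \<and> w \<sqsubseteq> b"
  shows "arrow S a B"
  using assms le_closed by (subst arrow_iff) auto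

lemma arrowE:
  assumes "arrow S a B" "a \<in> carrier S" "B \<subseteq> carrier S" "x \<sqsubseteq> a" "x \<noteq> \<zero>"
  obtains b w where "b \<in> B" "w \<in> carrier S" "w \<noteq> \<zero>" "w \<sqsubseteq> x" "w \<sqsubseteq> b"
  using assms le_closed by (subst (asm) arrow_iff) blast+

lemma arrow_trans:
  assumes "arrow S a B" "set_arrow S B C" "a \<in> carrier S" "B \<subseteq> carrier S" "C \<subseteq> carrier S"
  shows "arrow S a C"
proof (rule arrowI)
  fix x assume x: "x \<in> carrier S" "x \<sqsubseteq> a" "x \<noteq> \<zero>"
  obtain b w where b: "b \<in> B" "w \<in> carrier S" "w \<noteq> \<zero>" "w \<sqsubseteq> x" "w \<sqsubseteq> b"
    using arrowE[of a B x] assms x by metis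
  moreover obtain c v where "c \<in> C" "v \<in> carrier S" "v \<noteq> \<zero>" "v \<sqsubseteq> w" "v \<sqsubseteq> c"
    using arrowE[of b C w] assms b by (metis set_arrow_def subsetD)
  ultimately show "\<exists>b\<in>C. \<exists>w. w \<noteq> \<zero> \<and> w \<sqsubseteq> x \<and> w \<sqsubseteq> b"
    using x le_trans by blast
qed (use assms in auto)

lemma arrow_of_le:
  assumes "x \<sqsubseteq> b" "b \<in> B" "B \<subseteq> carrier S"
  shows "arrow S x B"
proof (rule arrowI)
  have b: "b \<in> carrier S" using assms by auto
  then show "x \<in> carrier S" using assms le_closed by blast
  fix z assume "z \<in> carrier S" "z \<sqsubseteq> x" "z \<noteq> \<zero>"
  then show "\<exists>b\<in>B. \<exists>w. w \<noteq> \<zero> \<and> w \<sqsubseteq> z \<and> w \<sqsubseteq> b"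
    using assms le_trans b le_refl by blast
qed fact

lemma arrow_mem: "b \<in> B \<Longrightarrow> B \<subseteq> carrier S \<Longrightarrow> arrow S b B"
  by (rule arrow_of_le[of b b]) auto

lemma arrow_mono: "arrow S a B \<Longrightarrow> B \<subseteq> C \<Longrightarrow> arrow S a C"
  unfolding arrow_def by blast

lemma arrow_le_trans:
  assumes "arrow S a B" "x \<sqsubseteq> a" "a \<in> carrier S" "B \<subseteq> carrier S"
  shows "arrow S x B"
  using arrow_trans[of x "{a}" B] arrow_of_le[of x a "{a}"] assms le_closed
  by (auto simp: set_arrow_def)

lemma arrow_eq_zero:
  assumes "arrow S a B" "B \<subseteq> {\<zero>}" "a \<in> carrier S"
  shows "a = \<zero>"
proof (rule ccontr)
  assume "a \<noteq> \<zero>"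
  moreover have "B \<subseteq> carrier S" using assms by auto
  ultimately show False using arrowE[of a B a] assms by (metis le_refl le_zero singletonD subsetD)
qed

lemma zero_arrow [simp]: "arrow S \<zero> B"
  by (auto simp: arrow_def)

text \<open>A non-zero \<open>u\<close> below \<open>c a\<close> is pulled back to
  \<open>c^-1 u\<close> below \<open>a\<close>, the arrow is applied there, and the common lower
  bound found is pushed forward by \<open>c\<close>.\<close>

lemma arrow_mult_left:
  assumes "arrow S a B" "a \<in> carrier S" "B \<subseteq> carrier S" "c \<in> carrier S"
  shows "arrow S (c \<cdot> a) ((\<lambda>b. c \<cdot> b) ` B)"
proof (rule arrowI)
  fix u assume u: "u \<in> carrier S" "u \<sqsubseteq> c \<cdot> a" "u \<noteq> \<zero>"
  define v where "v = sinv S c \<cdot> u"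
  have cv: "c \<cdot> v = u" unfolding v_def using le_mult_absorb_left u assms by blast
  have "v \<sqsubseteq> sinv S c \<cdot> (c \<cdot> a)" unfolding v_def using u assms by (intro le_mult) auto
  also have "\<dots> = (sinv S c \<cdot> c) \<cdot> a" using assms by (simp add: mult_assoc)
  finally have "v \<sqsubseteq> a" using idem_absorb_le(1)[of "sinv S c \<cdot> c" a] assms le_trans by simp
  moreover have "v \<noteq> \<zero>" using cv u assms by auto
  ultimately obtain b w where b: "b \<in> B" and w: "w \<in> carrier S" "w \<noteq> \<zero>" "w \<sqsubseteq> v" "w \<sqsubseteq> b"
    using arrowE[of a B v] assms by metis
  have vc: "v \<in> carrier S" using assms u by (simp add: v_def)
  \<comment> \<open>Pushing forward cannot produce zero: since \<open>w\<close> lies below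
    \<open>c^-1 u\<close>, it is recovered from \<open>c w\<close> by multiplying with
    \<open>c^-1\<close>.\<close>
  have "sinv S c \<cdot> (sinv S (sinv S c) \<cdot> w) = w"
    using le_mult_absorb_left[OF w(3)[unfolded v_def]] u assms by simp
  then have "c \<cdot> w \<noteq> \<zero>" using w assms by auto
  moreover have "c \<cdot> w \<sqsubseteq> u"
    unfolding cv[symmetric] using w assms vc by (intro le_mult) auto
  moreover have "c \<cdot> w \<sqsubseteq> c \<cdot> b"
    using w assms b by (intro le_mult) auto
  ultimately show "\<exists>b\<in>(\<lambda>b. c \<cdot> b) ` B. \<exists>w. w \<noteq> \<zero> \<and> w \<sqsubseteq> u \<and> w \<sqsubseteq> b"
    using b by blast
qed (use assms in auto)

lemma arrow_mult_right:
  assumes "arrow S a B" "a \<in> carrier S" "B \<subseteq> carrier S" "c \<in> carrier S"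
  shows "arrow S (a \<cdot> c) ((\<lambda>b. b \<cdot> c) ` B)"
proof (rule arrowI)
  fix u assume u: "u \<in> carrier S" "u \<sqsubseteq> a \<cdot> c" "u \<noteq> \<zero>"
  define v where "v = u \<cdot> sinv S c"
  have cv: "v \<cdot> c = u"
    unfolding v_def using le_mult_absorb_right[of u a c] u assms by (simp add: mult_assoc)
  have "v \<sqsubseteq> (a \<cdot> c) \<cdot> sinv S c" unfolding v_def using u assms by (intro le_mult) auto
  also have "\<dots> = a \<cdot> (c \<cdot> sinv S c)" using assms by (simp add: mult_assoc)
  finally have "v \<sqsubseteq> a" using idem_absorb_le(2)[of "c \<cdot> sinv S c" a] assms le_trans by simp
  moreover have "v \<noteq> \<zero>" using cv u assms by auto
  ultimately obtain b w where b: "b \<in> B" and w: "w \<in> carrier S" "w \<noteq> \<zero>" "w \<sqsubseteq> v" "w \<sqsubseteq> b"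
    using arrowE[of a B v] assms by metis
  have vc: "v \<in> carrier S" using assms u by (simp add: v_def)
  have "w \<cdot> (sinv S (sinv S c) \<cdot> sinv S c) = w"
    using le_mult_absorb_right[OF w(3)[unfolded v_def]] u assms by simp
  then have "(w \<cdot> c) \<cdot> sinv S c = w" using w assms by (simp add: mult_assoc)
  then have "w \<cdot> c \<noteq> \<zero>" using w assms by auto
  moreover have "w \<cdot> c \<sqsubseteq> u"
    unfolding cv[symmetric] using w assms vc by (intro le_mult) auto
  moreover have "w \<cdot> c \<sqsubseteq> b \<cdot> c"
    using w assms b by (intro le_mult) auto
  ultimately show "\<exists>b\<in>(\<lambda>b. b \<cdot> c) ` B. \<exists>w. w \<noteq> \<zero> \<and> w \<sqsubseteq> u \<and> w \<sqsubseteq> b"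
    using b by blast
qed (use assms in auto)

text \<open>Turns an arbitrary covering set into one consisting of elements below \<open>a\<close>:
  a common lower bound of \<open>x \<sqsubseteq> a\<close> and \<open>b\<close> is already below
  \<open>a \<sqinter> b\<close>.\<close>

lemma arrow_meet:
  assumes "arrow S a B" "a \<in> carrier S" "B \<subseteq> carrier S"
  shows "arrow S a ((\<lambda>b. a \<sqinter> b) ` B)"
proof (rule arrowI)
  fix x assume x: "x \<in> carrier S" "x \<sqsubseteq> a" "x \<noteq> \<zero>"
  then obtain b w where b: "b \<in> B" and w: "w \<in> carrier S" "w \<noteq> \<zero>" "w \<sqsubseteq> x" "w \<sqsubseteq> b"
    using arrowE[of a B x] assms by metis
  moreover have "w \<sqsubseteq> a \<sqinter> b"
    using b w x assms le_trans by (intro meet_greatest) auto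
  ultimately show "\<exists>b\<in>(\<lambda>b. a \<sqinter> b) ` B. \<exists>w. w \<noteq> \<zero> \<and> w \<sqsubseteq> x \<and> w \<sqsubseteq> b"
    by blast
qed (use assms in auto)

lemma set_arrow_trans:
  assumes "set_arrow S A B" "set_arrow S B C" "A \<subseteq> carrier S" "B \<subseteq> carrier S" "C \<subseteq> carrier S"
  shows "set_arrow S A C"
  using assms arrow_trans[of _ B C] unfolding set_arrow_def by auto

lemma set_arrow_of_subset: "A \<subseteq> B \<Longrightarrow> B \<subseteq> carrier S \<Longrightarrow> set_arrow S A B"
  using arrow_mem unfolding set_arrow_def by auto

lemma set_arrow_down:
  assumes "A \<subseteq> carrier S"
  shows "set_arrow S (down S A) A" "set_arrow S A (down S A)"
  using assms arrow_of_le[of _ _ A] set_arrow_of_subset[OF subset_down]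
  by (auto simp: set_arrow_def down_def)

text \<open>A set and the ideal it generates cover each other. Hence the relation on ideals can be
  tested on any generators.\<close>

lemma set_arrow_down_iff:
  assumes "A \<subseteq> carrier S" "B \<subseteq> carrier S"
  shows "set_arrow S (down S A) (down S B) \<longleftrightarrow> set_arrow S A B"
  using set_arrow_trans[of A "down S A" "down S B"] set_arrow_trans[of A "down S B" B]
    set_arrow_trans[of "down S A" A B] set_arrow_trans[of "down S A" B "down S B"]
    set_arrow_down[of A] set_arrow_down[of B] assms by auto

end

section \<open>Quotients by congruences\<close>

text \<open>Instantiated twice, once for each quotient in the completion: with
  \<open>biarrow_rel\<close> on the given semigroup and with \<open>FC_rel\<close> on the
  ideals.\<close>

locale inverse_congruence = inverse_semigroup0 +
  fixes R
  assumes equiv_R: "equiv (carrier S) R"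
    and cong_R: "(x, y) \<in> R \<Longrightarrow> (u, v) \<in> R \<Longrightarrow> (x \<cdot> u, y \<cdot> v) \<in> R"
begin

abbreviation Q where "Q \<equiv> quotient_semigroup S R"

definition cls where "cls x = R `` {x}"

lemma R_closed: "(x, y) \<in> R \<Longrightarrow> x \<in> carrier S \<and> y \<in> carrier S"
  using equiv_R by (auto simp: equiv_def)

lemma R_refl: "x \<in> carrier S \<Longrightarrow> (x, x) \<in> R"
  using equiv_R by (auto simp: equiv_def refl_on_def)

lemma R_sym: "(x, y) \<in> R \<Longrightarrow> (y, x) \<in> R"
  using equiv_R by (auto simp: equiv_def sym_def)

lemma R_trans: "(x, y) \<in> R \<Longrightarrow> (y, z) \<in> R \<Longrightarrow> (x, z) \<in> R"
  using equiv_R by (auto simp: equiv_def trans_def)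

lemma carrier_Q: "carrier Q = cls ` carrier S"
  by (auto simp: quotient_semigroup_def quotient_def cls_def)

lemma cls_closed [simp]: "x \<in> carrier S \<Longrightarrow> cls x \<in> carrier Q"
  by (simp add: carrier_Q)

lemma zero_Q: "\<zero>\<^bsub>Q\<^esub> = cls \<zero>"
  by (simp add: quotient_semigroup_def cls_def)

lemma cls_eq:
  assumes "x \<in> carrier S" "y \<in> carrier S"
  shows "cls x = cls y \<longleftrightarrow> (x, y) \<in> R"
  unfolding cls_def by (rule eq_equiv_class_iff[OF equiv_R assms])

lemma mult_Q:
  assumes "x \<in> carrier S" "y \<in> carrier S"
  shows "cls x \<cdot>\<^bsub>Q\<^esub> cls y = cls (x \<cdot> y)"
proof -
  have "cls (u \<cdot> v) = cls (x \<cdot> y)" if "(x, u) \<in> R" "(y, v) \<in> R" for u v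
    using cls_eq R_sym[OF cong_R[OF that]] R_closed[OF cong_R[OF that]] by simp
  then have "(\<Union>u\<in>cls x. \<Union>v\<in>cls y. cls (u \<cdot> v)) = (\<Union>u\<in>cls x. \<Union>v\<in>cls y. cls (x \<cdot> y))"
    by (intro SUP_cong refl) (auto simp: cls_def)
  moreover have "cls x \<noteq> {}" "cls y \<noteq> {}" using assms R_refl by (auto simp: cls_def)
  ultimately show ?thesis by (simp add: quotient_semigroup_def flip: cls_def)
qed

lemma idempotents_Q: "idempotents Q = cls ` idempotents S"
proof (intro equalityI subsetI)
  fix X assume X: "X \<in> idempotents Q"
  then obtain s where s: "s \<in> carrier S" "X = cls s" by (auto simp: idempotents_def[of Q] carrier_Q)
  then have ss: "(s \<cdot> s, s) \<in> R"
    using X by (simp add: idempotents_def[of Q] mult_Q cls_eq)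
  text \<open>Lallement's lemma: if \<open>s\<close> is congruent to its square, then \<open>s (s s)\<^sup>-\<^sup>1 s\<close> is an
    idempotent congruent to \<open>s\<close>.\<close>
  define y where "y = sinv S (s \<cdot> s)"
  have y: "y \<in> carrier S" using s by (simp add: y_def)
  have yssy: "y \<cdot> (s \<cdot> (s \<cdot> y)) = y"
    using sinv_mult_sinv[of "s \<cdot> s"] s y by (simp add: mult_assoc flip: y_def)
  have "(s \<cdot> (y \<cdot> s)) \<cdot> (s \<cdot> (y \<cdot> s)) = s \<cdot> ((y \<cdot> (s \<cdot> (s \<cdot> y))) \<cdot> s)"
    using s y by (simp add: mult_assoc)
  then have idem: "s \<cdot> (y \<cdot> s) \<in> idempotents S"
    using s y by (intro idemI) (simp_all add: yssy)
  have "((s \<cdot> s) \<cdot> (y \<cdot> (s \<cdot> s)), s \<cdot> (y \<cdot> s)) \<in> R"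
    using ss R_refl[OF y] by (intro cong_R)
  moreover have "(s \<cdot> s) \<cdot> (y \<cdot> (s \<cdot> s)) = s \<cdot> s"
    unfolding y_def using s by (intro inv_cancel) simp
  ultimately have "(s, s \<cdot> (y \<cdot> s)) \<in> R"
    using ss R_sym R_trans by metis
  then have "X = cls (s \<cdot> (y \<cdot> s))"
    using s y by (simp add: cls_eq)
  then show "X \<in> cls ` idempotents S" using idem by blast
next
  fix X assume "X \<in> cls ` idempotents S"
  then show "X \<in> idempotents Q" by (auto simp: idempotents_def[of Q] mult_Q idem_closed)
qed

lemma inverse_semigroup_Q: "inverse_semigroup0 Q"
proof (rule inverse_semigroup0I)
  fix X assume "X \<in> carrier Q"
  then obtain x where x: "x \<in> carrier S" "X = cls x" by (auto simp: carrier_Q)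
  then show "\<exists>Y\<in>carrier Q. X \<cdot>\<^bsub>Q\<^esub> Y \<cdot>\<^bsub>Q\<^esub> X = X"
    by (intro bexI[of _ "cls (sinv S x)"]) (simp_all add: mult_Q mult_sinv_mult)
next
  fix X Y assume "X \<in> idempotents Q" "Y \<in> idempotents Q"
  then show "X \<cdot>\<^bsub>Q\<^esub> Y = Y \<cdot>\<^bsub>Q\<^esub> X"
    unfolding idempotents_Q using idem_commute by (auto simp: mult_Q idem_closed)
qed (auto simp: carrier_Q mult_Q mult_assoc zero_Q)

end

sublocale inverse_congruence \<subseteq> Q: inverse_semigroup0 Q
  by (rule inverse_semigroup_Q)

context inverse_congruence
begin

lemma sinv_Q:
  assumes "x \<in> carrier S"
  shows "sinv Q (cls x) = cls (sinv S x)"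
  using assms by (intro Q.sinv_unique) (simp_all add: mult_Q mult_sinv_mult sinv_mult_sinv)

lemma le_Q:
  assumes "x \<in> carrier S" "y \<in> carrier S"
  shows "cls x \<sqsubseteq>\<^bsub>Q\<^esub> cls y \<longleftrightarrow> (\<exists>e\<in>idempotents S. (x, y \<cdot> e) \<in> R)"
  unfolding nat_le_def idempotents_Q using assms by (auto simp: mult_Q cls_eq idem_closed)

end

section \<open>The separated quotient\<close>

text \<open>The finite set \<open>C\<close> stands for the relative complement \<open>b \<setminus> a\<close> in the distributive completion.\<close>
definition relative_complements :: "'a semigroup0 \<Rightarrow> bool" where
  "relative_complements S \<longleftrightarrow> (\<forall>a\<in>idempotents S. \<forall>b\<in>idempotents S.
     \<exists>C. finite C \<and> C \<subseteq> idempotents S \<and> (\<forall>c\<in>C. a \<cdot>\<^bsub>S\<^esub> c = \<zero>\<^bsub>S\<^esub>) \<and> arrow S b (insert a C))"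

text \<open>Separation enters the argument in \<open>idem_of_arrow\<close>, where an element and an
  idempotent that cover each other have to be identified.\<close>

locale separated_semigroup = inverse_meet_semigroup +
  assumes separated: "a \<in> carrier S \<Longrightarrow> b \<in> carrier S \<Longrightarrow> arrow S a {b} \<Longrightarrow> arrow S b {a} \<Longrightarrow> a = b"

context inverse_meet_semigroup
begin

lemma biarrow_rel_iff:
  "(a, b) \<in> biarrow_rel S \<longleftrightarrow>
    a \<in> carrier S \<and> b \<in> carrier S \<and> arrow S a {b} \<and> arrow S b {a}"
  by (auto simp: biarrow_rel_def set_biarrow_def set_arrow_def)

lemma arrow_mult:
  assumes "arrow S x {y}" "arrow S u {v}" "{x, y, u, v} \<subseteq> carrier S"
  shows "arrow S (x \<cdot> u) {y \<cdot> v}"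
  using arrow_trans[of "x \<cdot> u" "{y \<cdot> u}" "{y \<cdot> v}"] arrow_mult_left[of u "{v}" y]
    arrow_mult_right[of x "{y}" u] assms by (auto simp: set_arrow_def)

lemma biarrow_congruence: "inverse_congruence S (biarrow_rel S)"
proof
  have "trans (biarrow_rel S)"
  proof (rule transI)
    fix x y z assume "(x, y) \<in> biarrow_rel S" "(y, z) \<in> biarrow_rel S"
    then show "(x, z) \<in> biarrow_rel S"
      using arrow_trans[of x "{y}" "{z}"] arrow_trans[of z "{y}" "{x}"]
      by (auto simp: biarrow_rel_iff set_arrow_def)
  qed
  then show "equiv (carrier S) (biarrow_rel S)"
    by (intro equivI) (auto simp: refl_on_def sym_def biarrow_rel_iff intro: arrow_mem)
qed (auto simp: biarrow_rel_iff intro: arrow_mult)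

end

sublocale inverse_meet_semigroup \<subseteq> sep: inverse_congruence S "biarrow_rel S"
  by (rule biarrow_congruence)

context inverse_meet_semigroup
begin

text \<open>If \<open>x\<close> is covered by \<open>y\<close>, then \<open>x \<sqinter> y\<close>
  represents the class of \<open>x\<close> and lies below \<open>y\<close> before passing to
  classes. Conversely a restriction of \<open>y\<close> is covered by \<open>y\<close>.\<close>

lemma le_sep:
  assumes "x \<in> carrier S" "y \<in> carrier S"
  shows "sep.cls x \<sqsubseteq>\<^bsub>sep.Q\<^esub> sep.cls y \<longleftrightarrow> arrow S x {y}"
proof
  assume "sep.cls x \<sqsubseteq>\<^bsub>sep.Q\<^esub> sep.cls y"
  then obtain e where e: "e \<in> idempotents S" "(x, y \<cdot> e) \<in> biarrow_rel S"
    using assms by (auto simp: sep.le_Q)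
  have "arrow S (y \<cdot> e) {y}"
    using e assms by (intro arrow_of_le[of _ y] idem_absorb_le) auto
  then show "arrow S x {y}"
    using e arrow_trans[of x "{y \<cdot> e}" "{y}"] assms by (auto simp: biarrow_rel_iff set_arrow_def)
next
  assume *: "arrow S x {y}"
  obtain e where e: "e \<in> idempotents S" "x \<sqinter> y = y \<cdot> e"
    using meet_le2 assms by (auto simp: nat_le_def)
  have "(x, x \<sqinter> y) \<in> biarrow_rel S"
    using arrow_meet[OF *] assms arrow_of_le[OF meet_le1[OF assms], of "{x}"]
    by (auto simp: biarrow_rel_iff)
  then show "sep.cls x \<sqsubseteq>\<^bsub>sep.Q\<^esub> sep.cls y"
    using e assms by (auto simp: sep.le_Q)
qed

lemma cls_eq_zero: "x \<in> carrier S \<Longrightarrow> sep.cls x = \<zero>\<^bsub>sep.Q\<^esub> \<longleftrightarrow> x = \<zero>"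
  using arrow_eq_zero[of x "{\<zero>}"] by (auto simp: sep.zero_Q sep.cls_eq biarrow_rel_iff)

text \<open>For a class below both, the two arrows are applied in succession: an element is shrunk
  below \<open>x\<close>, and the result is shrunk below \<open>y\<close>, hence below
  \<open>x \<sqinter> y\<close>.\<close>

lemma is_meet_sep:
  assumes "x \<in> carrier S" "y \<in> carrier S"
  shows "is_meet sep.Q (sep.cls x) (sep.cls y) (sep.cls (x \<sqinter> y))"
proof -
  have "arrow S z {x \<sqinter> y}"
    if z: "z \<in> carrier S" "arrow S z {x}" "arrow S z {y}" for z
  proof (rule arrowI)
    fix u assume u: "u \<in> carrier S" "u \<sqsubseteq> z" "u \<noteq> \<zero>"
    then obtain v where v: "v \<in> carrier S" "v \<noteq> \<zero>" "v \<sqsubseteq> u" "v \<sqsubseteq> x"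
      using arrowE[of z "{x}" u] z assms by (metis empty_subsetI insert_subset singletonD)
    then have "v \<sqsubseteq> z" using u z le_trans by blast
    then obtain w where w: "w \<in> carrier S" "w \<noteq> \<zero>" "w \<sqsubseteq> v" "w \<sqsubseteq> y"
      using arrowE[of z "{y}" v] z assms v by (metis empty_subsetI insert_subset singletonD)
    have "w \<sqsubseteq> u" "w \<sqsubseteq> x" using w v u assms le_trans by blast+
    then show "\<exists>b\<in>{x \<sqinter> y}. \<exists>w. w \<noteq> \<zero> \<and> w \<sqsubseteq> u \<and> w \<sqsubseteq> b"
      using w assms meet_greatest by blast
  qed (use assms z in auto)
  then show ?thesis
    using assms arrow_of_le[OF meet_le1[OF assms], of "{x}"] arrow_of_le[OF meet_le2[OF assms], of "{y}"]
    by (auto simp: is_meet_def le_sep sep.carrier_Q)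
qed

lemma inverse_meet_semigroup_sep: "inverse_meet_semigroup sep.Q"
proof
  fix X Y assume "X \<in> carrier sep.Q" "Y \<in> carrier sep.Q"
  then show "\<exists>m. is_meet sep.Q X Y m" using is_meet_sep by (auto simp: sep.carrier_Q)
qed

lemma meet_sep:
  assumes "x \<in> carrier S" "y \<in> carrier S"
  shows "sep.cls x \<sqinter>\<^bsub>sep.Q\<^esub> sep.cls y = sep.cls (x \<sqinter> y)"
  using inverse_meet_semigroup.meet_eqI[OF inverse_meet_semigroup_sep is_meet_sep[OF assms]] assms
  by simp

text \<open>Passing to classes preserves meets and sends only \<open>\<zero>\<close> to zero, so the
  non-vanishing of a meet is the same on both sides. The test elements are the \<open>x\<close>
  covered by \<open>a\<close> rather than those below it, which composition of arrows makes
  harmless.\<close>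

lemma arrow_sep:
  assumes "a \<in> carrier S" "B \<subseteq> carrier S"
  shows "arrow sep.Q (sep.cls a) (sep.cls ` B) \<longleftrightarrow> arrow S a B"
proof
  assume *: "arrow S a B"
  have **: "\<exists>b\<in>B. x \<sqinter> b \<noteq> \<zero>" if "x \<in> carrier S" "arrow S x {a}" "x \<noteq> \<zero>" for x
  proof -
    have "arrow S x B"
      using arrow_trans[of x "{a}" B] that * assms by (auto simp: set_arrow_def)
    then show ?thesis using that unfolding arrow_def by auto
  qed
  then show "arrow sep.Q (sep.cls a) (sep.cls ` B)"
    unfolding arrow_def[of sep.Q] using assms
    by (auto simp: sep.carrier_Q le_sep cls_eq_zero meet_sep subset_iff dest!: **)
next
  assume *: "arrow sep.Q (sep.cls a) (sep.cls ` B)"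
  show "arrow S a B"
    unfolding arrow_def
  proof (intro ballI impI)
    fix x assume x: "x \<in> carrier S" "x \<sqsubseteq> a \<and> x \<noteq> \<zero>"
    then have "\<exists>b\<in>B. sep.cls x \<sqinter>\<^bsub>sep.Q\<^esub> sep.cls b \<noteq> \<zero>\<^bsub>sep.Q\<^esub>"
      using * arrow_of_le[of x a "{a}"] assms unfolding arrow_def[of sep.Q]
      by (auto simp: le_sep cls_eq_zero)
    then show "\<exists>b\<in>B. x \<sqinter> b \<noteq> \<zero>"
      using x assms by (metis meet_sep cls_eq_zero meet_closed subsetD)
  qed
qed

lemma separated_semigroup_sep: "separated_semigroup (separated S)"
  unfolding separated_def separated_semigroup_def separated_semigroup_axioms_def
proof (intro conjI allI impI)
  fix A B
  assume *: "A \<in> carrier sep.Q" "B \<in> carrier sep.Q" "arrow sep.Q A {B}" "arrow sep.Q B {A}"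
  then obtain a b where "a \<in> carrier S" "b \<in> carrier S" "A = sep.cls a" "B = sep.cls b"
    by (auto simp: sep.carrier_Q)
  with * show "A = B"
    using arrow_sep[of a "{b}"] arrow_sep[of b "{a}"] by (simp add: sep.cls_eq biarrow_rel_iff)
qed (rule inverse_meet_semigroup_sep)

text \<open>Idempotent classes have idempotent representatives, so a finite set of them is the image
  of a finite set of idempotents; orthogonality and the arrow then pass back and forth clause by
  clause.\<close>

lemma relative_complements_sep: "relative_complements (separated S) \<longleftrightarrow> relative_complements S"
proof -
  have *: "(\<exists>C. finite C \<and> C \<subseteq> idempotents sep.Q \<and>
        (\<forall>c\<in>C. sep.cls a \<cdot>\<^bsub>sep.Q\<^esub> c = \<zero>\<^bsub>sep.Q\<^esub>) \<and> arrow sep.Q (sep.cls b) (insert (sep.cls a) C))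
    \<longleftrightarrow> (\<exists>C. finite C \<and> C \<subseteq> idempotents S \<and> (\<forall>c\<in>C. a \<cdot> c = \<zero>) \<and> arrow S b (insert a C))"
    (is "?L \<longleftrightarrow> ?R")
    if "a \<in> idempotents S" "b \<in> idempotents S" for a b
  proof -
    have **: "(\<forall>c\<in>sep.cls ` C. sep.cls a \<cdot>\<^bsub>sep.Q\<^esub> c = \<zero>\<^bsub>sep.Q\<^esub>) \<and> arrow sep.Q (sep.cls b) (insert (sep.cls a) (sep.cls ` C))
      \<longleftrightarrow> (\<forall>c\<in>C. a \<cdot> c = \<zero>) \<and> arrow S b (insert a C)" if C: "C \<subseteq> idempotents S" for C
    proof -
      have "C \<subseteq> carrier S" "a \<in> carrier S" "b \<in> carrier S"
        using C \<open>a \<in> idempotents S\<close> \<open>b \<in> idempotents S\<close> idem_closed by auto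
      then show ?thesis
        using arrow_sep[of b "insert a C"] by (auto simp: sep.mult_Q cls_eq_zero subset_iff)
    qed
    show ?thesis
      unfolding sep.idempotents_Q ex_finite_subset_image
      by (rule ex_cong1, rule conj_cong[OF refl], rule conj_cong[OF refl], rule **)
  qed
  show ?thesis
    unfolding relative_complements_def separated_def
    unfolding sep.idempotents_Q ball_simps
    by (intro ball_cong refl *[unfolded sep.idempotents_Q])
qed

end

section \<open>Finitely generated compatible ideals\<close>

context inverse_semigroup0
begin

section \<open>Compatible sets\<close>

lemma compatible_setI:
  assumes "\<And>s t. s \<in> A \<Longrightarrow> t \<in> A \<Longrightarrow> sinv S s \<cdot> t \<in> idempotents S"
    and "\<And>s t. s \<in> A \<Longrightarrow> t \<in> A \<Longrightarrow> s \<cdot> sinv S t \<in> idempotents S"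
  shows "compatible_set S A"
  using assms unfolding compatible_set_def by blast+

lemma compatible_setD:
  assumes "compatible_set S A" "s \<in> A" "t \<in> A"
  shows "sinv S s \<cdot> t \<in> idempotents S" "s \<cdot> sinv S t \<in> idempotents S"
  using assms unfolding compatible_set_def by blast+

lemma compatible_idempotents: "A \<subseteq> idempotents S \<Longrightarrow> compatible_set S A"
  by (rule compatible_setI) (auto simp: subset_iff)

lemma compatible_subset: "compatible_set S B \<Longrightarrow> A \<subseteq> B \<Longrightarrow> compatible_set S A"
  unfolding compatible_set_def by blast

lemma compatible_down:
  assumes "compatible_set S A" "A \<subseteq> carrier S"
  shows "compatible_set S (down S A)"
proof (rule compatible_setI)
  fix s t assume "s \<in> down S A" "t \<in> down S A"
  then obtain a b where ab: "a \<in> A" "b \<in> A" "s \<sqsubseteq> a" "t \<sqsubseteq> b" by (auto simp: down_def)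
  have cl: "a \<in> carrier S" "b \<in> carrier S" using ab assms by auto
  have "sinv S s \<cdot> t \<sqsubseteq> sinv S a \<cdot> b" "s \<cdot> sinv S t \<sqsubseteq> a \<cdot> sinv S b"
    by (intro le_mult le_sinv ab sinv_closed cl)+
  then show "sinv S s \<cdot> t \<in> idempotents S" "s \<cdot> sinv S t \<in> idempotents S"
    using compatible_setD[OF assms(1) ab(1,2)] by (simp_all only: le_idem)
qed

lemma mem_down: "x \<in> down S A \<longleftrightarrow> x \<in> carrier S \<and> (\<exists>a\<in>A. x \<sqsubseteq> a)"
  by (simp add: down_def)

section \<open>Multiplication, inverses and idempotents of ideals\<close>

lemma FC_iff: "X \<in> carrier (FC S) \<longleftrightarrow> (\<exists>A. generates S A X)"
  by (simp add: FC_def)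

lemma FC_down_closed [intro]: "generates S A (down S A) \<Longrightarrow> down S A \<in> carrier (FC S)"
  by (auto simp: FC_iff)

lemma zero_FC: "\<zero>\<^bsub>FC S\<^esub> = {\<zero>}"
  by (simp add: FC_def)

lemma mult_FC: "X \<cdot>\<^bsub>FC S\<^esub> Y = {x \<cdot> y | x y. x \<in> X \<and> y \<in> Y}"
  by (simp add: FC_def)

lemma mult_FC_I: "x \<in> X \<Longrightarrow> y \<in> Y \<Longrightarrow> x \<cdot> y \<in> X \<cdot>\<^bsub>FC S\<^esub> Y"
  by (auto simp: mult_FC)

lemma FC_carrier: "X \<in> carrier (FC S) \<Longrightarrow> x \<in> X \<Longrightarrow> x \<in> carrier S"
  by (auto simp: FC_iff generates_def down_def)

lemma FC_le:
  assumes "X \<in> carrier (FC S)" "y \<in> X" "x \<sqsubseteq> y"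
  shows "x \<in> X"
proof -
  obtain A where A: "A \<subseteq> carrier S" "X = down S A" using assms by (auto simp: FC_iff generates_def)
  then obtain a where "a \<in> A" "y \<sqsubseteq> a" "y \<in> carrier S" using assms by (auto simp: down_def)
  then have "x \<sqsubseteq> a" "x \<in> carrier S"
    using A assms le_closed[of x y] le_trans[of x y a] by auto
  then show ?thesis using A \<open>a \<in> A\<close> by (auto simp: down_def)
qed

lemma FC_compatible:
  assumes "X \<in> carrier (FC S)"
  shows "compatible_set S X"
  using assms compatible_down by (auto simp: FC_iff generates_def)

lemma FC_nonempty:
  assumes "X \<in> carrier (FC S)"
  shows "\<exists>x. x \<in> X"
proof -
  obtain A a where "a \<in> A" "A \<subseteq> carrier S" "X = down S A"
    using assms by (auto simp: FC_iff generates_def)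
  then have "a \<in> X" using le_refl mem_down by blast
  then show ?thesis ..
qed

text \<open>In \<open>(a b)^-1 (c d) = b^-1 (a^-1 c) d\<close> the inner factor is idempotent and
  only shrinks the idempotent \<open>b^-1 d\<close>; the other condition is symmetric. An element
  below \<open>a b\<close> is \<open>a (b e)\<close> with \<open>e\<close> idempotent, so the
  product of the ideals is downward closed.\<close>

lemma generates_mult:
  assumes "generates S A X" "generates S B Y"
  shows "generates S ((\<lambda>(a, b). a \<cdot> b) ` (A \<times> B)) (X \<cdot>\<^bsub>FC S\<^esub> Y)"
proof -
  have A: "A \<subseteq> carrier S" "compatible_set S A" "X = down S A"
    and B: "B \<subseteq> carrier S" "compatible_set S B" "Y = down S B"
    using assms by (auto simp: generates_def)
  let ?C = "(\<lambda>(a, b). a \<cdot> b) ` (A \<times> B)"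
  have "compatible_set S ?C"
  proof (rule compatible_setI)
    fix s t assume "s \<in> ?C" "t \<in> ?C"
    then obtain a b c d where s: "s = a \<cdot> b" "t = c \<cdot> d" and m: "a \<in> A" "b \<in> B" "c \<in> A" "d \<in> B"
      by auto
    have cl: "a \<in> carrier S" "b \<in> carrier S" "c \<in> carrier S" "d \<in> carrier S" using m A B by auto
    have "sinv S s \<cdot> t = sinv S b \<cdot> ((sinv S a \<cdot> c) \<cdot> d)"
      using cl by (simp add: s sinv_mult mult_assoc)
    also have "\<dots> \<sqsubseteq> sinv S b \<cdot> d"
      using compatible_setD[OF A(2) m(1,3)] cl by (intro le_mult le_refl idem_absorb_le) auto
    finally show "sinv S s \<cdot> t \<in> idempotents S"
      using compatible_setD[OF B(2) m(2,4)] le_idem by blast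
    have "s \<cdot> sinv S t = (a \<cdot> (b \<cdot> sinv S d)) \<cdot> sinv S c"
      using cl by (simp add: s sinv_mult mult_assoc)
    also have "\<dots> \<sqsubseteq> a \<cdot> sinv S c"
      using compatible_setD[OF B(2) m(2,4)] cl by (intro le_mult le_refl idem_absorb_le) auto
    finally show "s \<cdot> sinv S t \<in> idempotents S"
      using compatible_setD[OF A(2) m(1,3)] le_idem by blast
  qed
  moreover have "X \<cdot>\<^bsub>FC S\<^esub> Y = down S ?C"
  proof (intro equalityI subsetI)
    fix z assume "z \<in> X \<cdot>\<^bsub>FC S\<^esub> Y"
    then obtain x y a b where z: "z = x \<cdot> y" "a \<in> A" "x \<sqsubseteq> a" "b \<in> B" "y \<sqsubseteq> b"
        "x \<in> carrier S" "y \<in> carrier S"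
      by (auto simp: mult_FC A B down_def)
    then have "z \<sqsubseteq> a \<cdot> b" "z \<in> carrier S"
      using A(1) B(1) by (auto intro!: le_mult)
    moreover have "a \<cdot> b \<in> ?C" using z by blast
    ultimately show "z \<in> down S ?C" unfolding mem_down by blast
  next
    fix z assume "z \<in> down S ?C"
    then obtain a b e where m: "a \<in> A" "b \<in> B" "e \<in> idempotents S" "z = a \<cdot> b \<cdot> e"
      by (auto simp: down_def nat_le_def)
    have cl: "a \<in> carrier S" "b \<in> carrier S" "e \<in> carrier S" using m A B idem_closed by auto
    have "z = a \<cdot> (b \<cdot> e)" using m cl by (simp add: mult_assoc)
    moreover have "b \<cdot> e \<in> Y" unfolding B mem_down using m cl idem_absorb_le(2) by auto
    moreover have "a \<in> X" unfolding A mem_down using m cl le_refl by blast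
    ultimately show "z \<in> X \<cdot>\<^bsub>FC S\<^esub> Y" by (auto simp: mult_FC)
  qed
  moreover have "?C \<subseteq> carrier S" "finite ?C" "?C \<noteq> {}"
    using A(1) B(1) assms by (auto simp: generates_def intro!: mult_closed)
  ultimately show ?thesis unfolding generates_def by blast
qed

lemma mult_FC_closed:
  "X \<in> carrier (FC S) \<Longrightarrow> Y \<in> carrier (FC S) \<Longrightarrow> X \<cdot>\<^bsub>FC S\<^esub> Y \<in> carrier (FC S)"
  unfolding FC_iff using generates_mult by blast

lemma generates_sinv:
  assumes "generates S A X"
  shows "generates S (sinv S ` A) (sinv S ` X)"
proof -
  have A: "A \<subseteq> carrier S" "compatible_set S A" "X = down S A"
    using assms by (auto simp: generates_def)
  have "sinv S ` X = down S (sinv S ` A)"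
  proof (intro equalityI subsetI)
    fix x assume "x \<in> sinv S ` X"
    then obtain y a where y: "x = sinv S y" "y \<in> carrier S" "y \<sqsubseteq> a" "a \<in> A"
      unfolding A(3) mem_down by (auto simp: mem_down)
    then have "x \<sqsubseteq> sinv S a" using A(1) le_sinv by blast
    then show "x \<in> down S (sinv S ` A)" using y by (auto simp: mem_down)
  next
    fix x assume "x \<in> down S (sinv S ` A)"
    then obtain a where a: "a \<in> A" "x \<in> carrier S" "x \<sqsubseteq> sinv S a" by (auto simp: mem_down)
    then have "sinv S x \<in> X" unfolding A mem_down using A a le_sinv[OF a(3)] by (auto simp: subset_iff)
    then show "x \<in> sinv S ` X" using a by (intro image_eqI[of _ _ "sinv S x"]) simp_all
  qed
  moreover have "compatible_set S (sinv S ` A)"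
    by (rule compatible_setI) (use A compatible_setD[OF A(2)] in \<open>auto simp: subset_iff\<close>)
  ultimately show ?thesis using assms unfolding generates_def by auto
qed

lemma sinv_FC_closed: "X \<in> carrier (FC S) \<Longrightarrow> sinv S ` X \<in> carrier (FC S)"
  using generates_sinv by (auto simp: FC_iff)

lemma mult_FC_assoc:
  assumes "X \<in> carrier (FC S)" "Y \<in> carrier (FC S)" "Z \<in> carrier (FC S)"
  shows "X \<cdot>\<^bsub>FC S\<^esub> Y \<cdot>\<^bsub>FC S\<^esub> Z = X \<cdot>\<^bsub>FC S\<^esub> (Y \<cdot>\<^bsub>FC S\<^esub> Z)"
proof -
  have "(x \<cdot> y) \<cdot> z = x \<cdot> (y \<cdot> z)" if "x \<in> X" "y \<in> Y" "z \<in> Z" for x y z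
    using that assms FC_carrier mult_assoc by simp
  note assoc = this
  show ?thesis
  proof (intro equalityI subsetI)
    fix w assume "w \<in> X \<cdot>\<^bsub>FC S\<^esub> Y \<cdot>\<^bsub>FC S\<^esub> Z"
    then obtain x y z where "w = (x \<cdot> y) \<cdot> z" "x \<in> X" "y \<in> Y" "z \<in> Z"
      unfolding mult_FC by blast
    then show "w \<in> X \<cdot>\<^bsub>FC S\<^esub> (Y \<cdot>\<^bsub>FC S\<^esub> Z)" using assoc by (simp add: mult_FC_I)
  next
    fix w assume "w \<in> X \<cdot>\<^bsub>FC S\<^esub> (Y \<cdot>\<^bsub>FC S\<^esub> Z)"
    then obtain x y z where "w = x \<cdot> (y \<cdot> z)" "x \<in> X" "y \<in> Y" "z \<in> Z"
      unfolding mult_FC by blast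
    then show "w \<in> X \<cdot>\<^bsub>FC S\<^esub> Y \<cdot>\<^bsub>FC S\<^esub> Z" by (simp add: mult_FC_I flip: assoc)
  qed
qed

text \<open>For \<open>y\<close> and \<open>v\<close> in a compatible ideal, \<open>y v^-1\<close>
  is idempotent, so \<open>y v^-1 w\<close> lies below \<open>w\<close>. With \<open>W = Y\<close>
  this gives regularity; in general it exhibits a smaller ideal as a restriction of
  \<open>Y\<close>.\<close>

lemma mult_FC_sinv_absorb:
  assumes "Y \<in> carrier (FC S)" "W \<in> carrier (FC S)" "W \<subseteq> Y"
  shows "Y \<cdot>\<^bsub>FC S\<^esub> (sinv S ` W \<cdot>\<^bsub>FC S\<^esub> W) = W"
proof (intro equalityI subsetI)
  fix z assume "z \<in> Y \<cdot>\<^bsub>FC S\<^esub> (sinv S ` W \<cdot>\<^bsub>FC S\<^esub> W)"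
  then obtain y v w where z: "z = y \<cdot> (sinv S v \<cdot> w)" and m: "y \<in> Y" "v \<in> W" "w \<in> W"
    by (auto simp: mult_FC)
  have cl: "y \<in> carrier S" "v \<in> carrier S" "w \<in> carrier S" using m assms FC_carrier by blast+
  have "y \<cdot> sinv S v \<in> idempotents S"
    using compatible_setD(2)[OF FC_compatible[OF assms(1)]] m assms by blast
  then have "z \<sqsubseteq> w"
    using z cl idem_absorb_le(1)[of "y \<cdot> sinv S v" w] by (simp add: mult_assoc)
  then show "z \<in> W" using m assms FC_le by blast
next
  fix z assume z: "z \<in> W"
  then have "z = z \<cdot> (sinv S z \<cdot> z)" using assms FC_carrier by simp
  moreover have "z \<cdot> (sinv S z \<cdot> z) \<in> Y \<cdot>\<^bsub>FC S\<^esub> (sinv S ` W \<cdot>\<^bsub>FC S\<^esub> W)"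
    using z assms by (intro mult_FC_I) auto
  ultimately show "z \<in> Y \<cdot>\<^bsub>FC S\<^esub> (sinv S ` W \<cdot>\<^bsub>FC S\<^esub> W)" by simp
qed

text \<open>If \<open>x = y z\<close> within a compatible ideal, then \<open>x\<close> lies below
  both factors. From \<open>x \<sqsubseteq> y\<close> follows
  \<open>x^-1 x = y^-1 x = y^-1 y z\<close>, which lies below \<open>z\<close>. So \<open>x\<close>
  and \<open>x^-1 x\<close> are both equal to \<open>z (x^-1 x)\<close>.\<close>

lemma idempotents_FC: "idempotents (FC S) = {X \<in> carrier (FC S). X \<subseteq> idempotents S}"
proof (intro equalityI subsetI)
  fix X assume "X \<in> idempotents (FC S)"
  then have X: "X \<in> carrier (FC S)" "X \<cdot>\<^bsub>FC S\<^esub> X = X" by (auto simp: idempotents_def)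
  have "x \<in> idempotents S" if x: "x \<in> X" for x
  proof -
    obtain y z where x_eq: "x = y \<cdot> z" and m: "y \<in> X" "z \<in> X"
      using x X(2)[symmetric] unfolding mult_FC by blast
    have cl: "x \<in> carrier S" "y \<in> carrier S" "z \<in> carrier S" using m x X FC_carrier by auto
    have idem: "sinv S y \<cdot> x \<in> idempotents S" "x \<cdot> sinv S z \<in> idempotents S"
      using compatible_setD[OF FC_compatible[OF X(1)]] m x by auto
    have "x = y \<cdot> (sinv S y \<cdot> x)" using cl by (simp add: x_eq)
    then have "x \<sqsubseteq> y" by (rule le_rightI[OF idem(1)])
    then have 1: "sinv S y \<cdot> x = sinv S x \<cdot> x" using cl sinv_mult_of_le by blast
    have "x = (x \<cdot> sinv S z) \<cdot> z" using cl by (simp add: x_eq mult_assoc)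
    then have xz: "x \<sqsubseteq> z" using cl idem by (intro le_leftI)
    have "sinv S y \<cdot> x = (sinv S y \<cdot> y) \<cdot> z" using cl by (simp add: x_eq mult_assoc)
    then have "sinv S x \<cdot> x \<sqsubseteq> z" using idem_absorb_le(1)[of "sinv S y \<cdot> y" z] cl 1 by simp
    then have "sinv S x \<cdot> x = z \<cdot> (sinv S (sinv S x \<cdot> x) \<cdot> (sinv S x \<cdot> x))"
      using cl by (subst (asm) le_iff_right) auto
    also have "\<dots> = z \<cdot> (sinv S x \<cdot> x)" using cl by simp
    also have "\<dots> = x" using xz cl le_iff_right by metis
    finally show ?thesis using cl sinv_mult_idem by metis
  qed
  with X show "X \<in> {X \<in> carrier (FC S). X \<subseteq> idempotents S}" by auto
next
  fix X assume X: "X \<in> {X \<in> carrier (FC S). X \<subseteq> idempotents S}"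
  have "X \<cdot>\<^bsub>FC S\<^esub> X = X"
  proof (intro equalityI subsetI)
    fix z assume "z \<in> X \<cdot>\<^bsub>FC S\<^esub> X"
    then obtain x y where "z = x \<cdot> y" "x \<in> X" "y \<in> X" by (auto simp: mult_FC)
    then show "z \<in> X" using X FC_le idem_mult_le(1) by (metis (mono_tags) mem_Collect_eq subsetD)
  next
    fix z assume "z \<in> X"
    then show "z \<in> X \<cdot>\<^bsub>FC S\<^esub> X" using X mult_FC_I[of z X z X] by auto
  qed
  then show "X \<in> idempotents (FC S)" using X by (simp add: idempotents_def[of "FC S"])
qed

lemma generates_zero: "generates S {\<zero>} {\<zero>}"
  by (auto simp: generates_def down_def intro!: compatible_idempotents)

lemma inverse_semigroup_FC: "inverse_semigroup0 (FC S)"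
proof (rule inverse_semigroup0I)
  fix X assume "X \<in> carrier (FC S)"
  then show "\<exists>Y\<in>carrier (FC S). X \<cdot>\<^bsub>FC S\<^esub> Y \<cdot>\<^bsub>FC S\<^esub> X = X"
    using mult_FC_sinv_absorb[of X X] by (intro bexI[OF _ sinv_FC_closed])
      (simp_all add: mult_FC_assoc sinv_FC_closed)
next
  fix X Y assume "X \<in> idempotents (FC S)" "Y \<in> idempotents (FC S)"
  then have comm: "x \<cdot> y = y \<cdot> x" if "x \<in> X" "y \<in> Y" for x y
    using that idem_commute unfolding idempotents_FC by auto
  have "X \<cdot>\<^bsub>FC S\<^esub> Y = {y \<cdot> x | x y. x \<in> X \<and> y \<in> Y}"
    unfolding mult_FC by (intro Collect_cong ex_cong1) (metis comm)
  then show "X \<cdot>\<^bsub>FC S\<^esub> Y = Y \<cdot>\<^bsub>FC S\<^esub> X"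
    unfolding mult_FC by auto
next
  show "\<zero>\<^bsub>FC S\<^esub> \<in> carrier (FC S)"
    using generates_zero by (auto simp: FC_iff zero_FC)
next
  fix X assume X: "X \<in> carrier (FC S)"
  have "\<zero> \<cdot> x = \<zero>" "x \<cdot> \<zero> = \<zero>" if "x \<in> X" for x using FC_carrier[OF X that] by simp_all
  then show "\<zero>\<^bsub>FC S\<^esub> \<cdot>\<^bsub>FC S\<^esub> X = \<zero>\<^bsub>FC S\<^esub>" "X \<cdot>\<^bsub>FC S\<^esub> \<zero>\<^bsub>FC S\<^esub> = \<zero>\<^bsub>FC S\<^esub>"
    unfolding mult_FC zero_FC using FC_nonempty[OF X] by (auto, metis+)
qed (rule mult_FC_closed mult_FC_assoc; assumption)+

text \<open>Collecting generators keeps the set finite, so compatibility is the one condition on the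
  family that has to be supplied. Such unions represent the joins of the completion.\<close>

lemma FC_Union:
  assumes "\<X> \<subseteq> carrier (FC S)" "finite \<X>" "\<X> \<noteq> {}" "compatible_set S (\<Union>\<X>)"
  shows "\<Union>\<X> \<in> carrier (FC S)"
proof -
  have "\<forall>X\<in>\<X>. \<exists>A. generates S A X" using assms by (auto simp: FC_iff)
  then obtain g where g: "\<And>X. X \<in> \<X> \<Longrightarrow> generates S (g X) X" by metis
  have g': "g X \<subseteq> carrier S" "finite (g X)" "g X \<noteq> {}" "X = down S (g X)" if "X \<in> \<X>" for X
    using g[OF that] unfolding generates_def by blast+
  have sub: "g X \<subseteq> X" if "X \<in> \<X>" for X
    using subset_down[OF g'(1)[OF that]] g'(4)[OF that] by simp
  have "generates S (\<Union>(g ` \<X>)) (\<Union>\<X>)"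
    unfolding generates_def
  proof (intro conjI)
    show "\<Union>(g ` \<X>) \<noteq> {}" using g'(3) assms(3) by blast
    show "compatible_set S (\<Union>(g ` \<X>))"
      by (rule compatible_subset[OF assms(4)]) (use sub in blast)
    show "\<Union>\<X> = down S (\<Union>(g ` \<X>))"
    proof (intro equalityI subsetI)
      fix x assume "x \<in> \<Union>\<X>"
      then obtain X where X: "X \<in> \<X>" "x \<in> X" by blast
      then have "x \<in> down S (g X)" using g'(4) by simp
      then show "x \<in> down S (\<Union>(g ` \<X>))" unfolding mem_down using X by blast
    next
      fix x assume "x \<in> down S (\<Union>(g ` \<X>))"
      then obtain X where X: "X \<in> \<X>" "x \<in> down S (g X)" unfolding mem_down by blast
      then show "x \<in> \<Union>\<X>" using g'(4) by auto
    qed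
    show "finite (\<Union>(g ` \<X>))" using g'(2) assms(2) by blast
    show "\<Union>(g ` \<X>) \<subseteq> carrier S" using g'(1) by blast
  qed
  then show ?thesis by (auto simp: FC_iff)
qed

end

lemma (in inverse_semigroup0) sinv_FC:
  assumes "X \<in> carrier (FC S)"
  shows "sinv (FC S) X = sinv S ` X"
proof -
  have "sinv S ` (sinv S ` X) = X"
    using assms FC_carrier by (force simp: image_image)
  then show ?thesis
    using assms mult_FC_sinv_absorb[of X X] mult_FC_sinv_absorb[of "sinv S ` X" "sinv S ` X"]
    by (intro inverse_semigroup0.sinv_unique[OF inverse_semigroup_FC])
      (simp_all add: sinv_FC_closed mult_FC_assoc)
qed

section \<open>The distributive completion\<close>

context inverse_meet_semigroup
begin

text \<open>Expresses the relation by the ideals themselves, so that no generators have to be chosen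
  when it is used.\<close>

lemma FC_rel_iff:
  "(X, Y) \<in> FC_rel S \<longleftrightarrow>
    X \<in> carrier (FC S) \<and> Y \<in> carrier (FC S) \<and> set_arrow S X Y \<and> set_arrow S Y X"
proof -
  have "set_biarrow S A B \<longleftrightarrow> set_arrow S X Y \<and> set_arrow S Y X"
    if "generates S A X" "generates S B Y" for A B
    using that set_arrow_down_iff unfolding generates_def set_biarrow_def by auto
  then show ?thesis unfolding FC_rel_def by (auto simp: FC_iff)
qed

text \<open>One factor is replaced at a time, through \<open>Y \<cdot> U\<close>, so that the
  one-sided rules for multiplying arrows apply to each product.\<close>

lemma set_arrow_mult:
  assumes "set_arrow S X Y" "set_arrow S U V"
    and "X \<subseteq> carrier S" "Y \<subseteq> carrier S" "U \<subseteq> carrier S" "V \<subseteq> carrier S"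
  shows "set_arrow S (X \<cdot>\<^bsub>FC S\<^esub> U) (Y \<cdot>\<^bsub>FC S\<^esub> V)"
proof (rule set_arrow_trans[of _ "Y \<cdot>\<^bsub>FC S\<^esub> U"])
  show "set_arrow S (X \<cdot>\<^bsub>FC S\<^esub> U) (Y \<cdot>\<^bsub>FC S\<^esub> U)"
    unfolding set_arrow_def
  proof
    fix z assume "z \<in> X \<cdot>\<^bsub>FC S\<^esub> U"
    then obtain x u where z: "z = x \<cdot> u" "x \<in> X" "u \<in> U" by (auto simp: mult_FC)
    then have "arrow S (x \<cdot> u) ((\<lambda>y. y \<cdot> u) ` Y)"
      using assms by (intro arrow_mult_right) (auto simp: set_arrow_def)
    then show "arrow S z (Y \<cdot>\<^bsub>FC S\<^esub> U)"
      unfolding z(1) by (rule arrow_mono) (use z in \<open>auto simp: mult_FC\<close>)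
  qed
  show "set_arrow S (Y \<cdot>\<^bsub>FC S\<^esub> U) (Y \<cdot>\<^bsub>FC S\<^esub> V)"
    unfolding set_arrow_def
  proof
    fix z assume "z \<in> Y \<cdot>\<^bsub>FC S\<^esub> U"
    then obtain y u where z: "z = y \<cdot> u" "y \<in> Y" "u \<in> U" by (auto simp: mult_FC)
    then have "arrow S (y \<cdot> u) ((\<lambda>v. y \<cdot> v) ` V)"
      using assms by (intro arrow_mult_left) (auto simp: set_arrow_def)
    then show "arrow S z (Y \<cdot>\<^bsub>FC S\<^esub> V)"
      unfolding z(1) by (rule arrow_mono) (use z in \<open>auto simp: mult_FC\<close>)
  qed
qed (use assms in \<open>auto simp: mult_FC intro!: mult_closed\<close>)

lemma FC_subset: "X \<in> carrier (FC S) \<Longrightarrow> X \<subseteq> carrier S"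
  using FC_carrier by blast

lemma FC_congruence: "inverse_congruence (FC S) (FC_rel S)"
  unfolding inverse_congruence_def inverse_congruence_axioms_def
proof (intro conjI allI impI)
  have "trans (FC_rel S)"
  proof (rule transI)
    fix X Y Z assume "(X, Y) \<in> FC_rel S" "(Y, Z) \<in> FC_rel S"
    then show "(X, Z) \<in> FC_rel S"
      using set_arrow_trans[of X Y Z] set_arrow_trans[of Z Y X] FC_subset by (auto simp: FC_rel_iff)
  qed
  then show "equiv (carrier (FC S)) (FC_rel S)"
    using set_arrow_of_subset FC_subset
    by (intro equivI) (auto simp: refl_on_def sym_def FC_rel_iff)
next
  fix X Y U V assume "(X, Y) \<in> FC_rel S" "(U, V) \<in> FC_rel S"
  then show "(X \<cdot>\<^bsub>FC S\<^esub> U, Y \<cdot>\<^bsub>FC S\<^esub> V) \<in> FC_rel S"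
    using set_arrow_mult FC_subset mult_FC_closed by (auto simp: FC_rel_iff)
qed (rule inverse_semigroup_FC)

end

context separated_semigroup
begin

sublocale D: inverse_congruence "FC S" "FC_rel S"
  by (rule FC_congruence)

text \<open>If \<open>X\<close> is covered by \<open>Y\<close>, an ideal equivalent to
  \<open>X\<close> is found inside \<open>Y\<close>; every ideal inside \<open>Y\<close> is a
  restriction of \<open>Y\<close> by an idempotent ideal.\<close>

lemma le_D:
  assumes "X \<in> carrier (FC S)" "Y \<in> carrier (FC S)"
  shows "D.cls X \<sqsubseteq>\<^bsub>D.Q\<^esub> D.cls Y \<longleftrightarrow> set_arrow S X Y"
proof
  assume "D.cls X \<sqsubseteq>\<^bsub>D.Q\<^esub> D.cls Y"
  then obtain F where F: "F \<in> idempotents (FC S)" "(X, Y \<cdot>\<^bsub>FC S\<^esub> F) \<in> FC_rel S"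
    using assms by (auto simp: D.le_Q)
  have "Y \<cdot>\<^bsub>FC S\<^esub> F \<subseteq> Y"
  proof
    fix z assume "z \<in> Y \<cdot>\<^bsub>FC S\<^esub> F"
    then obtain y f where z: "z = y \<cdot> f" "y \<in> Y" "f \<in> F" by (auto simp: mult_FC)
    then have "z \<sqsubseteq> y" using F by (intro le_rightI[of f]) (auto simp: idempotents_FC)
    then show "z \<in> Y" using z assms FC_le by blast
  qed
  then show "set_arrow S X Y"
    using F set_arrow_of_subset[of "Y \<cdot>\<^bsub>FC S\<^esub> F" Y] set_arrow_trans[of X "Y \<cdot>\<^bsub>FC S\<^esub> F" Y]
      assms FC_subset by (simp add: FC_rel_iff)
next
  assume *: "set_arrow S X Y"
  obtain A B where A: "generates S A X" and B: "generates S B Y" using assms by (auto simp: FC_iff)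
  have cl: "A \<subseteq> carrier S" "B \<subseteq> carrier S" "X = down S A" "Y = down S B"
    using A B by (auto simp: generates_def)
  then have AB: "set_arrow S A B" using * set_arrow_down_iff by simp
  \<comment> \<open>Meets of generators lie in both ideals. They still cover every generator of
    \<open>X\<close>, since \<open>B\<close> does, and they are compatible as a subset of
    \<open>X\<close>.\<close>
  define C where "C = (\<lambda>(a, b). a \<sqinter> b) ` (A \<times> B)"
  have C: "C \<subseteq> carrier S" using cl by (auto simp: C_def intro!: meet_closed)
  have CX: "C \<subseteq> X" "C \<subseteq> Y"
  proof -
    have "a \<sqinter> b \<in> down S A \<and> a \<sqinter> b \<in> down S B" if "a \<in> A" "b \<in> B" for a b
    proof -
      have "a \<in> carrier S" "b \<in> carrier S" using that cl(1,2) by auto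
      then show ?thesis unfolding mem_down using that meet_closed meet_le1 meet_le2 by blast
    qed
    then show "C \<subseteq> X" "C \<subseteq> Y" unfolding C_def cl(3,4) by auto
  qed
  have "generates S C (down S C)"
    unfolding generates_def
  proof (intro conjI)
    show "finite C" "C \<noteq> {}" using A B unfolding generates_def C_def by simp_all
  qed (use C compatible_subset[OF FC_compatible[OF assms(1)] CX(1)] in simp_all)
  then have W: "down S C \<in> carrier (FC S)" by blast
  have "down S C \<subseteq> Y"
    using CX(2) FC_le[OF assms(2)] unfolding down_def by blast
  then have YF: "Y \<cdot>\<^bsub>FC S\<^esub> (sinv S ` down S C \<cdot>\<^bsub>FC S\<^esub> down S C) = down S C"
    using mult_FC_sinv_absorb assms W by blast
  have "set_arrow S A C"
    unfolding set_arrow_def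
  proof
    fix a assume a: "a \<in> A"
    then have "arrow S a ((\<lambda>b. a \<sqinter> b) ` B)"
      using AB cl by (intro arrow_meet) (auto simp: set_arrow_def)
    then show "arrow S a C" by (rule arrow_mono) (use a in \<open>auto simp: C_def\<close>)
  qed
  moreover have "set_arrow S C X" using CX FC_subset assms by (intro set_arrow_of_subset) auto
  then have "set_arrow S C A"
    using set_arrow_trans[of C X A] set_arrow_down(1)[of A] cl C by auto
  ultimately have "(X, Y \<cdot>\<^bsub>FC S\<^esub> (sinv S ` down S C \<cdot>\<^bsub>FC S\<^esub> down S C)) \<in> FC_rel S"
    unfolding YF
    using cl C W assms set_arrow_down_iff by (simp add: FC_rel_iff)
  moreover have "sinv S ` down S C \<cdot>\<^bsub>FC S\<^esub> down S C \<in> idempotents (FC S)"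
    using D.sinv_mult_idem[OF W] sinv_FC[OF W] by simp
  ultimately show "D.cls X \<sqsubseteq>\<^bsub>D.Q\<^esub> D.cls Y"
    unfolding D.le_Q[OF assms] by blast
qed

text \<open>If \<open>t\<close> is covered by idempotents, then \<open>t\<close> and \<open>t\<^sup>-\<^sup>1 t\<close> have the common cover formed by the
  meets of \<open>t\<close> with these idempotents, so the two are equal by separation.\<close>
lemma idem_of_arrow:
  assumes "t \<in> carrier S" "F \<subseteq> idempotents S" "arrow S t F"
  shows "t \<in> idempotents S"
proof -
  have F: "F \<subseteq> carrier S" using assms idem_closed by auto
  define e where "e = sinv S t \<cdot> t"
  have e: "e \<in> idempotents S" "e \<in> carrier S" using assms by (auto simp: e_def)
  define G where "G = (\<lambda>f. t \<sqinter> f) ` F"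
  have tG: "arrow S t G" unfolding G_def using assms F by (intro arrow_meet)
  have G: "g \<in> carrier S" "g \<sqsubseteq> t" "g \<in> idempotents S" if "g \<in> G" for g
    using that assms F meet_le1[of t] le_idem[OF meet_le2[of t]] unfolding G_def by auto
  have "g \<sqsubseteq> e" if "g \<in> G" for g
    unfolding e_def using G[OF that] assms idem_le_sinv_mult by blast
  then have "set_arrow S G {e}"
    using e arrow_of_le[of _ e "{e}"] by (auto simp: set_arrow_def)
  then have te: "arrow S t {e}"
    using arrow_trans[OF tG] assms G e by auto
  have et: "arrow S e {t}"
  proof (rule arrowI)
    fix x assume x: "x \<in> carrier S" "x \<sqsubseteq> e" "x \<noteq> \<zero>"
    have xi: "x \<in> idempotents S" using x e le_idem by blast
    have xe: "sinv S t \<cdot> (t \<cdot> x) = x"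
    proof -
      have "x = e \<cdot> x" using x e xi le_iff_right[of x e] by simp
      then show ?thesis using assms x by (simp add: e_def mult_assoc)
    qed
    have "t \<cdot> x \<sqsubseteq> t" using xi assms idem_absorb_le by blast
    moreover have "t \<cdot> x \<noteq> \<zero>" using xe x assms by auto
    ultimately obtain g z where g: "g \<in> G" and z: "z \<in> carrier S" "z \<noteq> \<zero>" "z \<sqsubseteq> t \<cdot> x" "z \<sqsubseteq> g"
      using arrowE[OF tG, of "t \<cdot> x"] assms G by (metis subsetI)
    \<comment> \<open>An idempotent below \<open>t x\<close> also lies below
      \<open>(t x)^-1 (t x)\<close>, which is \<open>x\<close>; this carries the common lower bound
      back from \<open>t x\<close> to \<open>x\<close>.\<close>
    have "z \<in> idempotents S" using z g G le_idem by blast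
    then have "z \<sqsubseteq> sinv S (t \<cdot> x) \<cdot> (t \<cdot> x)" using z assms x by (intro idem_le_sinv_mult) auto
    also have "\<dots> = x" using assms x xi xe by (simp add: sinv_mult mult_assoc)
    finally have "z \<sqsubseteq> x" .
    moreover have "z \<sqsubseteq> t" using z g G assms le_trans by blast
    ultimately show "\<exists>b\<in>{t}. \<exists>w. w \<noteq> \<zero> \<and> w \<sqsubseteq> x \<and> w \<sqsubseteq> b" using z by blast
  qed (use assms e in auto)
  then show ?thesis using separated[of t e] te assms e by simp
qed

text \<open>An idempotent class is represented by an ideal \<open>F\<close> of idempotents, which
  covers every element of \<open>X\<close>; \<open>idem_of_arrow\<close> then applies to each of
  them. Through this, compatibility of classes can be read in \<open>S\<close>.\<close>

lemma D_idempotent_pure: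
  assumes "X \<in> carrier (FC S)" "D.cls X \<in> idempotents D.Q"
  shows "X \<subseteq> idempotents S"
proof -
  obtain F where F: "F \<in> carrier (FC S)" "F \<subseteq> idempotents S" "D.cls X = D.cls F"
    using assms by (auto simp: D.idempotents_Q idempotents_FC)
  then have "set_arrow S X F" using assms by (simp add: D.cls_eq FC_rel_iff)
  then show ?thesis using assms F idem_of_arrow FC_carrier by (auto simp: set_arrow_def)
qed

text \<open>The order of the completion is the arrow between ideals, and an arrow out of a union is
  tested on each member separately.\<close>

lemma is_join_D:
  assumes "\<X> \<subseteq> carrier (FC S)" "\<Union>\<X> \<in> carrier (FC S)"
  shows "is_join D.Q (D.cls ` \<X>) (D.cls (\<Union>\<X>))"
  unfolding is_join_def
proof (intro conjI ballI impI)
  show "D.cls (\<Union>\<X>) \<in> carrier D.Q" using assms by simp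
next
  fix Y assume "Y \<in> D.cls ` \<X>"
  then obtain X where "X \<in> \<X>" "Y = D.cls X" by blast
  moreover from this have "set_arrow S X (\<Union>\<X>)"
    using FC_subset[OF assms(2)] by (intro set_arrow_of_subset) auto
  ultimately show "Y \<sqsubseteq>\<^bsub>D.Q\<^esub> D.cls (\<Union>\<X>)"
    using assms by (auto simp: le_D)
next
  fix Z assume Z: "Z \<in> carrier D.Q" "\<forall>a\<in>D.cls ` \<X>. a \<sqsubseteq>\<^bsub>D.Q\<^esub> Z"
  then obtain Y where Y: "Y \<in> carrier (FC S)" "Z = D.cls Y" by (auto simp: D.carrier_Q)
  then have "set_arrow S X Y" if "X \<in> \<X>" for X using that Z assms le_D by blast
  then show "D.cls (\<Union>\<X>) \<sqsubseteq>\<^bsub>D.Q\<^esub> Z" using Y assms by (simp add: le_D) (auto simp: set_arrow_def)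
qed

text \<open>For \<open>x \<in> X\<close> and \<open>y \<in> Y\<close> the element
  \<open>x^-1 y\<close> belongs to the ideal \<open>X^-1 Y\<close>. Its class is idempotent by
  assumption, so idempotent purity applies.\<close>

lemma compatible_D:
  assumes "\<X> \<subseteq> carrier (FC S)" "compatible_set D.Q (D.cls ` \<X>)"
  shows "compatible_set S (\<Union>\<X>)"
proof -
  have *: "sinv S x \<cdot> y \<in> idempotents S \<and> x \<cdot> sinv S y \<in> idempotents S"
    if m: "X \<in> \<X>" "Y \<in> \<X>" "x \<in> X" "y \<in> Y" for X Y x y
  proof -
    have XY: "X \<in> carrier (FC S)" "Y \<in> carrier (FC S)" using m assms by auto
    have "D.cls (sinv S ` X \<cdot>\<^bsub>FC S\<^esub> Y) = sinv D.Q (D.cls X) \<cdot>\<^bsub>D.Q\<^esub> D.cls Y"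
      "D.cls (X \<cdot>\<^bsub>FC S\<^esub> sinv S ` Y) = D.cls X \<cdot>\<^bsub>D.Q\<^esub> sinv D.Q (D.cls Y)"
      using XY by (simp_all add: D.sinv_Q sinv_FC D.mult_Q sinv_FC_closed)
    moreover have "sinv D.Q (D.cls X) \<cdot>\<^bsub>D.Q\<^esub> D.cls Y \<in> idempotents D.Q"
      "D.cls X \<cdot>\<^bsub>D.Q\<^esub> sinv D.Q (D.cls Y) \<in> idempotents D.Q"
      using assms(2) m unfolding compatible_set_def by blast+
    ultimately have "sinv S ` X \<cdot>\<^bsub>FC S\<^esub> Y \<subseteq> idempotents S" "X \<cdot>\<^bsub>FC S\<^esub> sinv S ` Y \<subseteq> idempotents S"
      using D_idempotent_pure XY mult_FC_closed sinv_FC_closed by metis+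
    then show ?thesis using m unfolding mult_FC by blast
  qed
  then show ?thesis by (intro compatible_setI) blast+
qed

text \<open>A finite compatible family of classes lifts to ideals whose union is again an ideal in
  \<open>FC\<close>. Multiplication of ideals distributes over unions as an equality of sets, so
  distributivity over joins needs no further covering argument.\<close>

lemma distributive_D: "distributive_inverse_semigroup D.Q"
  unfolding distributive_inverse_semigroup_def distributive_inverse_semigroup_axioms_def
proof (intro conjI allI impI)
  have obt: "\<exists>\<X>\<subseteq>carrier (FC S). \<A> = D.cls ` \<X> \<and> \<X> \<noteq> {} \<and> \<Union>\<X> \<in> carrier (FC S)"
    if A: "finite \<A>" "\<A> \<noteq> {}" "\<A> \<subseteq> carrier D.Q" "compatible_set D.Q \<A>" for \<A>
  proof -
    obtain \<X> where "\<X> \<subseteq> carrier (FC S)" "finite \<X>" "\<A> = D.cls ` \<X>"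
      using A(1,3) unfolding D.carrier_Q by (meson finite_subset_image)
    then show ?thesis using A FC_Union[of \<X>] compatible_D[of \<X>] by auto
  qed
  fix \<A> assume A: "finite \<A>" "\<A> \<noteq> {}" "\<A> \<subseteq> carrier D.Q" "compatible_set D.Q \<A>"
  obtain \<X> where X: "\<X> \<subseteq> carrier (FC S)" "\<A> = D.cls ` \<X>" "\<X> \<noteq> {}" "\<Union>\<X> \<in> carrier (FC S)"
    using obt[OF A] by blast
  show "\<exists>j. is_join D.Q \<A> j" using is_join_D X by auto
  fix j s assume j: "is_join D.Q \<A> j" and s: "s \<in> carrier D.Q"
  have jX: "j = D.cls (\<Union>\<X>)" using D.Q.join_unique[OF j] is_join_D X by auto
  obtain U where U: "U \<in> carrier (FC S)" "s = D.cls U" using s by (auto simp: D.carrier_Q)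
  have eq: "(\<lambda>X. U \<cdot>\<^bsub>FC S\<^esub> X) ` \<X> \<subseteq> carrier (FC S)" "(\<lambda>X. X \<cdot>\<^bsub>FC S\<^esub> U) ` \<X> \<subseteq> carrier (FC S)"
    "\<Union>((\<lambda>X. U \<cdot>\<^bsub>FC S\<^esub> X) ` \<X>) = U \<cdot>\<^bsub>FC S\<^esub> \<Union>\<X>" "\<Union>((\<lambda>X. X \<cdot>\<^bsub>FC S\<^esub> U) ` \<X>) = \<Union>\<X> \<cdot>\<^bsub>FC S\<^esub> U"
    using X U mult_FC_closed by (auto 4 4 simp: mult_FC)
  have "(\<lambda>a. s \<cdot>\<^bsub>D.Q\<^esub> a) ` \<A> = D.cls ` (\<lambda>X. U \<cdot>\<^bsub>FC S\<^esub> X) ` \<X>"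
    "(\<lambda>a. a \<cdot>\<^bsub>D.Q\<^esub> s) ` \<A> = D.cls ` (\<lambda>X. X \<cdot>\<^bsub>FC S\<^esub> U) ` \<X>"
    unfolding X(2) U(2) image_image using X U by (auto intro!: image_cong simp: D.mult_Q subset_iff)
  moreover have "s \<cdot>\<^bsub>D.Q\<^esub> j = D.cls (U \<cdot>\<^bsub>FC S\<^esub> \<Union>\<X>)" "j \<cdot>\<^bsub>D.Q\<^esub> s = D.cls (\<Union>\<X> \<cdot>\<^bsub>FC S\<^esub> U)"
    using X U jX by (simp_all add: D.mult_Q)
  ultimately show "is_join D.Q ((\<lambda>a. s \<cdot>\<^bsub>D.Q\<^esub> a) ` \<A>) (s \<cdot>\<^bsub>D.Q\<^esub> j)"
    "is_join D.Q ((\<lambda>a. a \<cdot>\<^bsub>D.Q\<^esub> s) ` \<A>) (j \<cdot>\<^bsub>D.Q\<^esub> s)"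
    using is_join_D[OF eq(1)] is_join_D[OF eq(2)] X U mult_FC_closed unfolding eq(3,4) by simp_all
qed (rule D.inverse_semigroup_Q)

end

section \<open>Relative complements\<close>

context inverse_semigroup0
begin

lemma idempotents_semilattice [simp]:
  "idempotents (idempotent_semilattice S) = idempotents S"
  unfolding idempotents_def idempotent_semilattice_def by auto

lemma semilattice_simps:
  "carrier (idempotent_semilattice S) = idempotents S"
  "x \<cdot>\<^bsub>idempotent_semilattice S\<^esub> y = x \<cdot> y"
  "\<zero>\<^bsub>idempotent_semilattice S\<^esub> = \<zero>"
  "x \<sqsubseteq>\<^bsub>idempotent_semilattice S\<^esub> y \<longleftrightarrow> x \<sqsubseteq> y"
  by (simp_all add: nat_le_def) (simp_all add: idempotent_semilattice_def)

lemma inverse_semigroup_semilattice: "inverse_semigroup0 (idempotent_semilattice S)"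
proof (rule inverse_semigroup0I, unfold semilattice_simps idempotents_semilattice)
  fix x y z assume "x \<in> idempotents S" "y \<in> idempotents S" "z \<in> idempotents S"
  then show "x \<cdot> y \<cdot> z = x \<cdot> (y \<cdot> z)" by (simp add: mult_assoc idem_closed)
next
  fix x assume "x \<in> idempotents S"
  then show "\<exists>y\<in>idempotents S. x \<cdot> y \<cdot> x = x" by (intro bexI[of _ x]) simp_all
qed (simp_all add: idem_commute idem_closed)

lemma is_meet_semilattice:
  assumes "e \<in> idempotents S" "f \<in> idempotents S"
  shows "is_meet (idempotent_semilattice S) e f (e \<cdot> f)"
  using assms idem_mult_le idem_le_mult unfolding is_meet_def semilattice_simps by simp

lemma meet_semilattice_semilattice: "meet_semilattice0 (idempotent_semilattice S)"
  unfolding meet_semilattice0_def meet_semilattice0_axioms_def inverse_meet_semigroup_def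
    inverse_meet_semigroup_axioms_def
  using inverse_semigroup_semilattice is_meet_semilattice by (auto simp: semilattice_simps)

lemma meet_semilattice:
  assumes "e \<in> idempotents S" "f \<in> idempotents S"
  shows "e \<sqinter>\<^bsub>idempotent_semilattice S\<^esub> f = e \<cdot> f"
proof -
  interpret E: meet_semilattice0 "idempotent_semilattice S" by (rule meet_semilattice_semilattice)
  show ?thesis using E.meet_eqI[OF is_meet_semilattice[OF assms]] assms by (simp add: semilattice_simps)
qed

lemma join_eqI: "is_join S {a, b} j \<Longrightarrow> a \<squnion> b = j"
  unfolding join_def using join_unique by (intro the_equality) auto

end

lemma (in inverse_meet_semigroup) meet_idempotents:
  assumes "e \<in> idempotents S" "f \<in> idempotents S"
  shows "e \<sqinter> f = e \<cdot> f"
proof (rule meet_eqI)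
  have "z \<sqsubseteq> e \<cdot> f" if "z \<sqsubseteq> e" "z \<sqsubseteq> f" for z using that assms idem_le_mult by blast
  then show "is_meet S e f (e \<cdot> f)"
    using assms idem_mult_le[OF assms] by (simp add: is_meet_def idem_closed)
qed (use assms idem_closed in auto)

text \<open>Everything below an idempotent is idempotent, and meets of idempotents are products in
  either structure; hence arrows between idempotents do not depend on where they are
  computed.\<close>

lemma (in inverse_meet_semigroup) relative_complements_semilattice:
  "relative_complements (idempotent_semilattice S) \<longleftrightarrow> relative_complements S"
proof -
  have "arrow (idempotent_semilattice S) b C \<longleftrightarrow> arrow S b C"
    if "b \<in> idempotents S" "C \<subseteq> idempotents S" for b C
  proof -
    have "x \<sqinter>\<^bsub>idempotent_semilattice S\<^esub> c = x \<sqinter> c" if "x \<in> idempotents S" "c \<in> C" for x c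
      using that \<open>C \<subseteq> idempotents S\<close> meet_idempotents meet_semilattice by (metis subsetD)
    then have "(\<exists>c\<in>C. x \<sqinter>\<^bsub>idempotent_semilattice S\<^esub> c \<noteq> \<zero>) \<longleftrightarrow> (\<exists>c\<in>C. x \<sqinter> c \<noteq> \<zero>)"
      if "x \<in> idempotents S" for x
      using that by (intro bex_cong refl) metis
    moreover have "x \<in> idempotents S" if "x \<sqsubseteq> b" for x
      using le_idem that \<open>b \<in> idempotents S\<close> by blast
    ultimately show ?thesis
      unfolding arrow_def semilattice_simps using idem_closed by blast
  qed
  note arrow_eq = this
  show ?thesis
    unfolding relative_complements_def idempotents_semilattice semilattice_simps
  proof (intro ball_cong refl ex_cong1)
    fix a b C assume "a \<in> idempotents S" "b \<in> idempotents S"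
    then show "(finite C \<and> C \<subseteq> idempotents S \<and> (\<forall>c\<in>C. a \<cdot> c = \<zero>) \<and>
        arrow (idempotent_semilattice S) b (insert a C)) \<longleftrightarrow>
      (finite C \<and> C \<subseteq> idempotents S \<and> (\<forall>c\<in>C. a \<cdot> c = \<zero>) \<and> arrow S b (insert a C))"
      using arrow_eq[of b "insert a C"] by (metis insert_subset)
  qed
qed

context distributive_inverse_semigroup
begin

lemma compatible_idem_pair: "a \<in> idempotents S \<Longrightarrow> b \<in> idempotents S \<Longrightarrow> compatible_set S {a, b}"
  by (rule compatible_idempotents) auto

text \<open>Idempotents below \<open>j\<close> lie below \<open>j^-1 j\<close>, which is therefore
  an upper bound; minimality puts \<open>j\<close> below this idempotent.\<close>

lemma join_idem:
  assumes "is_join S {a, b} j" "a \<in> idempotents S" "b \<in> idempotents S"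
  shows "j \<in> idempotents S"
proof -
  have j: "j \<in> carrier S" "a \<sqsubseteq> j" "b \<sqsubseteq> j" using assms by (auto simp: is_join_def)
  then have "a \<sqsubseteq> sinv S j \<cdot> j" "b \<sqsubseteq> sinv S j \<cdot> j" using assms idem_le_sinv_mult by auto
  then have "j \<sqsubseteq> sinv S j \<cdot> j" using assms j by (auto simp: is_join_def)
  then show ?thesis using j le_idem sinv_mult_idem by blast
qed

lemma is_join_semilattice:
  assumes "a \<in> idempotents S" "b \<in> idempotents S"
  shows "is_join (idempotent_semilattice S) {a, b} j \<longleftrightarrow> is_join S {a, b} j"
proof -
  interpret E: meet_semilattice0 "idempotent_semilattice S" by (rule meet_semilattice_semilattice)
  have *: "is_join (idempotent_semilattice S) {a, b} k" if "is_join S {a, b} k" for k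
    using that join_idem[OF that assms] idem_closed unfolding is_join_def semilattice_simps by auto
  obtain k where "is_join S {a, b} k"
    using ex_join[OF _ _ _ compatible_idem_pair[OF assms]] assms idem_closed by auto
  then show ?thesis using * E.join_unique by blast
qed

text \<open>A common \<open>j\<close> for both joins replaces an equation between values of
  \<open>\<squnion>\<close>. This form can be read off directly in the completion, where joins are
  known as classes of unions.\<close>

lemma boolean_iff_relative_complements:
  "boolean_inverse_semigroup S \<longleftrightarrow> (\<forall>a\<in>idempotents S. \<forall>b\<in>idempotents S. \<exists>c\<in>idempotents S.
     a \<cdot> c = \<zero> \<and> (\<exists>j. is_join S {a, b} j \<and> is_join S {a, c} j))" (is "_ \<longleftrightarrow> ?R")
proof -
  interpret E: meet_semilattice0 "idempotent_semilattice S" by (rule meet_semilattice_semilattice)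
  have ex: "\<exists>j. is_join S {a, b} j" if "a \<in> idempotents S" "b \<in> idempotents S" for a b
    using ex_join[OF _ _ _ compatible_idem_pair[OF that]] that idem_closed by auto
  have joinE: "a \<squnion>\<^bsub>idempotent_semilattice S\<^esub> b = j"
    if "is_join S {a, b} j" "a \<in> idempotents S" "b \<in> idempotents S" for a b j
    using that E.join_eqI is_join_semilattice by blast
  have distrib: "a \<cdot> (b \<squnion>\<^bsub>idempotent_semilattice S\<^esub> c)
      = (a \<cdot> b) \<squnion>\<^bsub>idempotent_semilattice S\<^esub> (a \<cdot> c)"
    "b \<squnion>\<^bsub>idempotent_semilattice S\<^esub> c \<in> idempotents S"
    if abc: "a \<in> idempotents S" "b \<in> idempotents S" "c \<in> idempotents S" for a b c
  proof -
    obtain j where j: "is_join S {b, c} j" using ex abc by blast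
    then have "is_join S {a \<cdot> b, a \<cdot> c} (a \<cdot> j)"
      using mult_join_left[OF _ _ _ compatible_idem_pair[OF abc(2,3)] j idem_closed[OF abc(1)]] abc idem_closed
      by auto
    then show "a \<cdot> (b \<squnion>\<^bsub>idempotent_semilattice S\<^esub> c)
        = (a \<cdot> b) \<squnion>\<^bsub>idempotent_semilattice S\<^esub> (a \<cdot> c)"
      using joinE[OF j abc(2,3)] joinE[of "a \<cdot> b" "a \<cdot> c"] abc by simp
    show "b \<squnion>\<^bsub>idempotent_semilattice S\<^esub> c \<in> idempotents S"
      using joinE[OF j abc(2,3)] join_idem[OF j abc(2,3)] by simp
  qed
  have "boolean_inverse_semigroup S \<longleftrightarrow> generalized_boolean_algebra (idempotent_semilattice S)"
    unfolding boolean_inverse_semigroup_def boolean_inverse_semigroup_axioms_def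
    using distributive_inverse_semigroup_axioms by blast
  also have "\<dots> \<longleftrightarrow> (\<forall>a\<in>idempotents S. \<forall>b\<in>idempotents S. \<exists>c\<in>idempotents S.
     a \<squnion>\<^bsub>idempotent_semilattice S\<^esub> b = a \<squnion>\<^bsub>idempotent_semilattice S\<^esub> c \<and> a \<cdot> c = \<zero>)"
  proof -
    have "\<exists>j. is_join (idempotent_semilattice S) {a, b} j"
      if "a \<in> idempotents S" "b \<in> idempotents S" for a b
      using that ex is_join_semilattice by blast
    moreover have "a \<sqinter>\<^bsub>idempotent_semilattice S\<^esub> (b \<squnion>\<^bsub>idempotent_semilattice S\<^esub> c) =
        (a \<sqinter>\<^bsub>idempotent_semilattice S\<^esub> b) \<squnion>\<^bsub>idempotent_semilattice S\<^esub> (a \<sqinter>\<^bsub>idempotent_semilattice S\<^esub> c)"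
      if "a \<in> idempotents S" "b \<in> idempotents S" "c \<in> idempotents S" for a b c
      using distrib[OF that] that by (simp only: meet_semilattice)
    moreover have "(\<exists>c\<in>idempotents S. P c \<and> a \<sqinter>\<^bsub>idempotent_semilattice S\<^esub> c = \<zero>) \<longleftrightarrow>
        (\<exists>c\<in>idempotents S. P c \<and> a \<cdot> c = \<zero>)" if "a \<in> idempotents S" for a P
      using that by (intro bex_cong refl) (simp add: meet_semilattice)
    ultimately show ?thesis
      unfolding generalized_boolean_algebra_def generalized_boolean_algebra_axioms_def semilattice_simps
      using E.meet_semilattice0_axioms by (simp add: Ball_def)
  qed
  also have "\<dots> \<longleftrightarrow> ?R"
  proof (intro ball_cong bex_cong refl)
    fix a b c assume abc: "a \<in> idempotents S" "b \<in> idempotents S" "c \<in> idempotents S"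
    obtain j k where j: "is_join S {a, b} j" and k: "is_join S {a, c} k" using ex abc by meson
    have "a \<squnion>\<^bsub>idempotent_semilattice S\<^esub> b = j" "a \<squnion>\<^bsub>idempotent_semilattice S\<^esub> c = k"
      using joinE[OF j] joinE[OF k] abc by auto
    moreover have "(\<exists>j. is_join S {a, b} j \<and> is_join S {a, c} j) \<longleftrightarrow> j = k"
      using j k join_unique by blast
    ultimately show "(a \<squnion>\<^bsub>idempotent_semilattice S\<^esub> b = a \<squnion>\<^bsub>idempotent_semilattice S\<^esub> c \<and> a \<cdot> c = \<zero>)
      \<longleftrightarrow> (a \<cdot> c = \<zero> \<and> (\<exists>j. is_join S {a, b} j \<and> is_join S {a, c} j))" by auto
  qed
  finally show ?thesis .
qed

end

context inverse_meet_semigroup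
begin

text \<open>The elements of \<open>A\<close> are removed one at a time: each piece \<open>c\<close>
  left over so far is split by a complement of the next \<open>a\<close>. Starting from
  \<open>b\<close> and multiplying pieces keeps everything below \<open>b\<close>.\<close>

lemma relative_complements_finite:
  assumes rc: "relative_complements S" and b: "b \<in> idempotents S"
    and "finite A" "A \<subseteq> idempotents S"
  shows "\<exists>C. finite C \<and> C \<subseteq> idempotents S \<and> (\<forall>a\<in>A. \<forall>c\<in>C. a \<cdot> c = \<zero>) \<and> (\<forall>c\<in>C. c \<sqsubseteq> b) \<and>
    arrow S b (A \<union> C)"
  using assms(3,4)
proof (induction A rule: finite_induct)
  case empty
  show ?case using b arrow_mem[of b "{b}"] idem_closed by (intro exI[of _ "{b}"]) auto
next
  case (insert a A)
  then have aA: "a \<in> idempotents S" "A \<subseteq> idempotents S" by auto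
  obtain C where C: "finite C" "C \<subseteq> idempotents S" "\<forall>a\<in>A. \<forall>c\<in>C. a \<cdot> c = \<zero>" "\<forall>c\<in>C. c \<sqsubseteq> b"
      "arrow S b (A \<union> C)"
    using insert.IH aA by blast
  have "\<forall>c\<in>C. \<exists>K. finite K \<and> K \<subseteq> idempotents S \<and> (\<forall>k\<in>K. a \<cdot> k = \<zero>) \<and> arrow S c (insert a K)"
    using rc aA C unfolding relative_complements_def by blast
  then obtain K where K: "\<And>c. c \<in> C \<Longrightarrow> finite (K c)" "\<And>c. c \<in> C \<Longrightarrow> K c \<subseteq> idempotents S"
      "\<And>c k. c \<in> C \<Longrightarrow> k \<in> K c \<Longrightarrow> a \<cdot> k = \<zero>" "\<And>c. c \<in> C \<Longrightarrow> arrow S c (insert a (K c))"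
    by metis
  \<comment> \<open>The factor \<open>c\<close> keeps a piece orthogonal to the old elements and
    below \<open>b\<close>, while the factor \<open>k\<close> makes it orthogonal to
    \<open>a\<close>.\<close>
  define C' where "C' = (\<Union>c\<in>C. (\<lambda>k. c \<cdot> k) ` K c)"
  have C': "\<exists>c\<in>C. \<exists>k\<in>K c. c' = c \<cdot> k" if "c' \<in> C'" for c' using that by (auto simp: C'_def)
  have "finite C'" unfolding C'_def using C K by auto
  moreover have "c' \<in> idempotents S \<and> (\<forall>d\<in>insert a A. d \<cdot> c' = \<zero>) \<and> c' \<sqsubseteq> b" if c': "c' \<in> C'" for c'
  proof -
    obtain c k where m: "c \<in> C" "k \<in> K c" "c' = c \<cdot> k" using C'[OF c'] by blast
    then have i: "c \<in> idempotents S" "k \<in> idempotents S" using C(2) K(2) by blast+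
    have "d \<cdot> c' = \<zero>" if d: "d \<in> A" for d
    proof -
      have "d \<in> carrier S" "d \<cdot> c = \<zero>" using d m aA C(3) idem_closed by blast+
      then show ?thesis using m i idem_closed by (simp flip: mult_assoc)
    qed
    moreover have "a \<cdot> c' = c \<cdot> (a \<cdot> k)"
      using m i aA idem_left_commute idem_closed by simp
    then have "a \<cdot> c' = \<zero>" using m i K(3) idem_closed by simp
    moreover have "c' \<sqsubseteq> b"
      using m i C(4) b idem_mult_le(1)[OF i] le_trans idem_closed by blast
    ultimately show ?thesis using m i by auto
  qed
  moreover have "arrow S b (insert a A \<union> C')"
  proof (rule arrow_trans[OF C(5)])
    have cl: "insert a A \<union> C' \<subseteq> carrier S" using aA calculation idem_closed by blast
    then show "insert a A \<union> C' \<subseteq> carrier S" .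
    show "set_arrow S (A \<union> C) (insert a A \<union> C')"
      unfolding set_arrow_def
    proof
      fix d assume "d \<in> A \<union> C"
      then consider "d \<in> A" | "d \<in> C" by blast
      then show "arrow S d (insert a A \<union> C')"
      proof cases
        case 1
        then show ?thesis by (intro arrow_mem[OF _ cl]) simp
      next
        case 2
        then have d: "d \<in> idempotents S" "d \<in> carrier S" using C(2) idem_closed by blast+
        have Kd: "insert a (K d) \<subseteq> carrier S" using aA K(2)[OF 2] idem_closed by blast
        \<comment> \<open>Multiplying the cover of the piece \<open>d\<close> by \<open>d\<close>
          replaces each \<open>k\<close> by a member of \<open>C'\<close>, and \<open>a\<close> by
          an element still below \<open>a\<close>.\<close>
        have "arrow S (d \<cdot> d) ((\<lambda>k. d \<cdot> k) ` insert a (K d))"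
          using K(4)[OF 2] d Kd by (intro arrow_mult_left)
        then have dK: "arrow S d ((\<lambda>k. d \<cdot> k) ` insert a (K d))" using d by simp
        show ?thesis
        proof (rule arrow_trans[OF dK])
          show "set_arrow S ((\<lambda>k. d \<cdot> k) ` insert a (K d)) (insert a A \<union> C')"
            unfolding set_arrow_def
          proof
            fix z assume "z \<in> (\<lambda>k. d \<cdot> k) ` insert a (K d)"
            then consider "z = d \<cdot> a" | "z \<in> C'" using 2 by (auto simp: C'_def)
            then show "arrow S z (insert a A \<union> C')"
            proof cases
              case 1
              then show ?thesis
                using idem_mult_le(2)[OF d(1) aA(1)] by (intro arrow_of_le[OF _ _ cl, of _ a]) simp_all
            next
              case 2
              then show ?thesis by (intro arrow_mem[OF _ cl]) simp
            qed
          qed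
          show "(\<lambda>k. d \<cdot> k) ` insert a (K d) \<subseteq> carrier S" using d Kd by auto
        qed (use d cl in auto)
      qed
    qed
  qed (use b C(2) aA idem_closed in blast)+
  ultimately show ?case by (intro exI[of _ C']) blast
qed

end

context separated_semigroup
begin

lemma idempotent_ideal:
  assumes "finite A" "A \<noteq> {}" "A \<subseteq> idempotents S"
  shows "down S A \<in> idempotents (FC S)"
proof -
  have "generates S A (down S A)"
    using assms compatible_idempotents idem_closed by (auto simp: generates_def)
  moreover have "down S A \<subseteq> idempotents S" using assms le_idem unfolding mem_down down_def by blast
  ultimately show ?thesis by (auto simp: idempotents_FC)
qed

text \<open>Idempotents of the completion come from ideals of idempotents. There joins are unions
  and orthogonality is elementwise, so a complement becomes a statement about ideals, and then about
  their generators.\<close>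

lemma boolean_D_iff: "boolean_inverse_semigroup D.Q \<longleftrightarrow> relative_complements S"
proof -
  interpret DD: distributive_inverse_semigroup D.Q by (rule distributive_D)
  have FC_idem: "F \<in> carrier (FC S)" "F \<subseteq> idempotents S" "F \<subseteq> carrier S" if "F \<in> idempotents (FC S)" for F
    using that idem_closed unfolding idempotents_FC by blast+
  have joins: "is_join D.Q {D.cls F, D.cls G} (D.cls (F \<union> G))" "F \<union> G \<in> carrier (FC S)"
    if "F \<in> idempotents (FC S)" "G \<in> idempotents (FC S)" for F G
  proof -
    have "compatible_set S (\<Union>{F, G})" using that FC_idem by (intro compatible_idempotents) auto
    then have "\<Union>{F, G} \<in> carrier (FC S)" using that FC_idem by (intro FC_Union) auto
    then show "is_join D.Q {D.cls F, D.cls G} (D.cls (F \<union> G))" "F \<union> G \<in> carrier (FC S)"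
      using that FC_idem is_join_D[of "{F, G}"] by auto
  qed
  have ex_join_iff: "(\<exists>j. is_join D.Q {D.cls F, D.cls G} j \<and> is_join D.Q {D.cls F, D.cls H} j) \<longleftrightarrow>
      set_arrow S (F \<union> G) (F \<union> H) \<and> set_arrow S (F \<union> H) (F \<union> G)"
    if "F \<in> idempotents (FC S)" "G \<in> idempotents (FC S)" "H \<in> idempotents (FC S)" for F G H
  proof -
    have "(\<exists>j. is_join D.Q {D.cls F, D.cls G} j \<and> is_join D.Q {D.cls F, D.cls H} j)
        \<longleftrightarrow> D.cls (F \<union> G) = D.cls (F \<union> H)"
      using joins(1)[OF that(1,2)] joins(1)[OF that(1,3)] D.Q.join_unique by metis
    then show ?thesis
      using joins(2)[OF that(1,2)] joins(2)[OF that(1,3)] by (simp add: D.cls_eq FC_rel_iff)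
  qed
  \<comment> \<open>Only \<open>\<zero>\<close> is covered by \<open>{\<zero>}\<close>, so a product
    of classes vanishes exactly when every product of members does.\<close>
  have zero_iff: "D.cls F \<cdot>\<^bsub>D.Q\<^esub> D.cls H = \<zero>\<^bsub>D.Q\<^esub> \<longleftrightarrow> (\<forall>f\<in>F. \<forall>h\<in>H. f \<cdot> h = \<zero>)"
    if "F \<in> carrier (FC S)" "H \<in> carrier (FC S)" for F H
  proof -
    have "D.cls F \<cdot>\<^bsub>D.Q\<^esub> D.cls H = \<zero>\<^bsub>D.Q\<^esub> \<longleftrightarrow> (F \<cdot>\<^bsub>FC S\<^esub> H, {\<zero>}) \<in> FC_rel S"
      using that mult_FC_closed D.zero_closed
      by (simp add: D.mult_Q D.zero_Q zero_FC D.cls_eq)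
    also have "\<dots> \<longleftrightarrow> set_arrow S (F \<cdot>\<^bsub>FC S\<^esub> H) {\<zero>}"
    proof -
      have "{\<zero>} \<in> carrier (FC S)" using D.zero_closed by (simp add: zero_FC)
      then show ?thesis using that mult_FC_closed by (auto simp: FC_rel_iff set_arrow_def)
    qed
    also have "\<dots> \<longleftrightarrow> (\<forall>z\<in>F \<cdot>\<^bsub>FC S\<^esub> H. z = \<zero>)"
      unfolding set_arrow_def
    proof (intro ball_cong refl)
      fix z assume "z \<in> F \<cdot>\<^bsub>FC S\<^esub> H"
      then show "arrow S z {\<zero>} \<longleftrightarrow> z = \<zero>"
        using arrow_eq_zero[of z "{\<zero>}"] FC_carrier[OF mult_FC_closed[OF that]] by auto
    qed
    also have "\<dots> \<longleftrightarrow> (\<forall>f\<in>F. \<forall>h\<in>H. f \<cdot> h = \<zero>)" unfolding mult_FC by blast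
    finally show ?thesis .
  qed
  have "boolean_inverse_semigroup D.Q \<longleftrightarrow>
    (\<forall>F\<in>idempotents (FC S). \<forall>G\<in>idempotents (FC S). \<exists>H\<in>idempotents (FC S).
      (\<forall>f\<in>F. \<forall>h\<in>H. f \<cdot> h = \<zero>) \<and>
      set_arrow S (F \<union> G) (F \<union> H) \<and> set_arrow S (F \<union> H) (F \<union> G))"
    unfolding DD.boolean_iff_relative_complements D.idempotents_Q ball_simps bex_simps
    by (intro ball_cong bex_cong refl conj_cong ex_join_iff zero_iff FC_idem)
  also have "\<dots> \<longleftrightarrow> relative_complements S"
  proof
    assume L: "\<forall>F\<in>idempotents (FC S). \<forall>G\<in>idempotents (FC S). \<exists>H\<in>idempotents (FC S).
      (\<forall>f\<in>F. \<forall>h\<in>H. f \<cdot> h = \<zero>) \<and>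
      set_arrow S (F \<union> G) (F \<union> H) \<and> set_arrow S (F \<union> H) (F \<union> G)"
    show "relative_complements S"
      unfolding relative_complements_def
    proof (intro ballI)
      fix a b assume ab: "a \<in> idempotents S" "b \<in> idempotents S"
      \<comment> \<open>Principal ideals suffice in this direction: generators of the complementary
        ideal serve as \<open>C\<close>.\<close>
      then have "down S {a} \<in> idempotents (FC S)" "down S {b} \<in> idempotents (FC S)"
        by (auto intro!: idempotent_ideal)
      then obtain H where H: "H \<in> idempotents (FC S)" "\<forall>f\<in>down S {a}. \<forall>h\<in>H. f \<cdot> h = \<zero>"
          "set_arrow S (down S {a} \<union> down S {b}) (down S {a} \<union> H)"
        using L by blast
      have m: "a \<in> down S {a}" "b \<in> down S {b}" using ab le_refl idem_closed unfolding mem_down by auto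
      obtain C where C: "generates S C H" using FC_idem(1)[OF H(1)] by (auto simp: FC_iff)
      then have C': "finite C" "C \<subseteq> carrier S" "H = down S C" unfolding generates_def by blast+
      then have CH: "C \<subseteq> H" using subset_down by simp
      have "arrow S b (down S {a} \<union> H)" using H(3) m by (auto simp: set_arrow_def)
      moreover have "down S {a} \<union> H = down S (insert a C)" unfolding C'(3) down_def by blast
      ultimately have "arrow S b (down S (insert a C))" by simp
      then have "arrow S b (insert a C)"
        using arrow_trans[of b "down S (insert a C)" "insert a C"] set_arrow_down(1)[of "insert a C"]
          ab C' idem_closed by auto
      then show "\<exists>C. finite C \<and> C \<subseteq> idempotents S \<and> (\<forall>c\<in>C. a \<cdot> c = \<zero>) \<and> arrow S b (insert a C)"
        using C'(1) CH H(2) m(1) FC_idem(2)[OF H(1)] by (intro exI[of _ C]) blast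
    qed
  next
    assume R: "relative_complements S"
    show "\<forall>F\<in>idempotents (FC S). \<forall>G\<in>idempotents (FC S). \<exists>H\<in>idempotents (FC S).
      (\<forall>f\<in>F. \<forall>h\<in>H. f \<cdot> h = \<zero>) \<and>
      set_arrow S (F \<union> G) (F \<union> H) \<and> set_arrow S (F \<union> H) (F \<union> G)"
    proof (intro ballI)
      fix F G assume FG: "F \<in> idempotents (FC S)" "G \<in> idempotents (FC S)"
      obtain A B where "generates S A F" "generates S B G"
        using FG FC_idem(1) unfolding FC_iff by meson
      then have A: "finite A" "A \<subseteq> carrier S" "F = down S A" and B: "finite B" "B \<subseteq> carrier S" "G = down S B"
        unfolding generates_def by blast+
      have AF: "A \<subseteq> F" and BG: "B \<subseteq> G" using A B subset_down by simp_all
      then have AB: "A \<subseteq> idempotents S" "B \<subseteq> idempotents S" using FG FC_idem(2) by blast+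
      have "\<forall>b\<in>B. \<exists>C. finite C \<and> C \<subseteq> idempotents S \<and> (\<forall>a\<in>A. \<forall>c\<in>C. a \<cdot> c = \<zero>) \<and> (\<forall>c\<in>C. c \<sqsubseteq> b) \<and>
          arrow S b (A \<union> C)"
        using relative_complements_finite[OF R _ A(1) AB(1)] AB(2) by blast
      from bchoice[OF this] obtain C where C: "\<forall>b\<in>B. finite (C b) \<and> C b \<subseteq> idempotents S \<and>
          (\<forall>a\<in>A. \<forall>c\<in>C b. a \<cdot> c = \<zero>) \<and> (\<forall>c\<in>C b. c \<sqsubseteq> b) \<and> arrow S b (A \<union> C b)" ..
      \<comment> \<open>All the sets \<open>C b\<close> may be empty, but an ideal in
        \<open>FC\<close> needs a non-empty generating set; \<open>\<zero>\<close> provides it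
        without affecting orthogonality or covering.\<close>
      define K where "K = insert \<zero> (\<Union>(C ` B))"
      have K: "finite K" "K \<noteq> {}" "K \<subseteq> idempotents S" using B(1) C unfolding K_def by auto
      then have Kc: "K \<subseteq> carrier S" using idem_closed by blast
      have KB: "\<exists>b\<in>B. k \<sqsubseteq> b" if "k \<in> K" "k \<noteq> \<zero>" for k using that C unfolding K_def by blast
      have AK: "a \<cdot> k = \<zero>" if "a \<in> A" "k \<in> K" for a k
      proof (cases "k = \<zero>")
        case True
        then show ?thesis using that A(2) by auto
      next
        case False
        then show ?thesis using that C unfolding K_def by blast
      qed
      have un: "F \<union> down S K = down S (A \<union> K)" "F \<union> G = down S (A \<union> B)"
        unfolding A(3) B(3) down_def by blast+
      have "f \<cdot> h = \<zero>" if fh: "f \<in> F" "h \<in> down S K" for f h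
      proof -
        obtain a k where ak: "a \<in> A" "k \<in> K" "f \<sqsubseteq> a" "h \<sqsubseteq> k" using fh A(3) by (auto simp: mem_down)
        then have "f \<cdot> h \<sqsubseteq> a \<cdot> k" using A(2) Kc by (intro le_mult) auto
        then show ?thesis using AK ak by simp
      qed
      note zero = this
      have cl: "A \<union> B \<subseteq> carrier S" "A \<union> K \<subseteq> carrier S" using A(2) B(2) Kc by simp_all
      have "set_arrow S (A \<union> B) (A \<union> K)"
        unfolding set_arrow_def
      proof
        fix x assume "x \<in> A \<union> B"
        then show "arrow S x (A \<union> K)"
        proof
          assume "x \<in> A"
          then show ?thesis by (intro arrow_mem[OF _ cl(2)]) simp
        next
          assume "x \<in> B"
          then show ?thesis unfolding K_def using C by (rule_tac arrow_mono[of x "A \<union> C x"]) blast+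
        qed
      qed
      moreover have "set_arrow S (A \<union> K) (A \<union> B)"
        unfolding set_arrow_def
      proof
        fix x assume "x \<in> A \<union> K"
        then consider "x \<in> A" | "x = \<zero>" | b where "b \<in> B" "x \<sqsubseteq> b" using KB by blast
        then show "arrow S x (A \<union> B)"
        proof cases
          case 1
          then show ?thesis by (intro arrow_mem[OF _ cl(1)]) simp
        next
          case 3
          then show ?thesis by (intro arrow_of_le[OF _ _ cl(1), of x b]) simp_all
        qed simp
      qed
      ultimately show "\<exists>H\<in>idempotents (FC S). (\<forall>f\<in>F. \<forall>h\<in>H. f \<cdot> h = \<zero>) \<and>
          set_arrow S (F \<union> G) (F \<union> H) \<and> set_arrow S (F \<union> H) (F \<union> G)"
        unfolding un(2)
        by (intro bexI[OF _ idempotent_ideal[OF K]], unfold un(1) set_arrow_down_iff[OF cl]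
          set_arrow_down_iff[OF cl(2,1)]) (use zero in blast)
    qed
  qed
  finally show ?thesis .
qed

end

text \<open>Every part of the theorem passes through this equivalence. It is obtained for the
  separated quotient and transferred down to \<open>S\<close>.\<close>

lemma (in inverse_meet_semigroup) pre_boolean_iff: "pre_boolean S \<longleftrightarrow> relative_complements S"
proof -
  interpret T: separated_semigroup "separated S" by (rule separated_semigroup_sep)
  show ?thesis
    unfolding pre_boolean_def distributive_completion_def T.boolean_D_iff relative_complements_sep ..
qed

section \<open>Tight filters and trapping\<close>

context meet_semilattice0
begin

lemma idempotents_eq: "idempotents E = carrier E"
  unfolding idempotents_def using all_idempotent by blast

lemma carrier_idem [simp]: "x \<in> carrier E \<Longrightarrow> x \<in> idempotents E"
  by (simp add: idempotents_eq)

lemma mult_commute: "x \<in> carrier E \<Longrightarrow> y \<in> carrier E \<Longrightarrow> x \<cdot> y = y \<cdot> x"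
  by (simp add: idem_commute)

lemma meet_eq_mult: "x \<in> carrier E \<Longrightarrow> y \<in> carrier E \<Longrightarrow> x \<sqinter> y = x \<cdot> y"
  by (simp add: meet_idempotents)

lemma mult_le:
  assumes "x \<in> carrier E" "y \<in> carrier E"
  shows "x \<cdot> y \<sqsubseteq> x" "x \<cdot> y \<sqsubseteq> y"
  using assms idem_mult_le by auto

section \<open>Filters and their extension by an element\<close>

lemma filter_closed: "meet_filter E F \<Longrightarrow> x \<in> F \<Longrightarrow> x \<in> carrier E"
  unfolding meet_filter_def by blast

lemma filter_up: "meet_filter E F \<Longrightarrow> x \<in> F \<Longrightarrow> x \<sqsubseteq> y \<Longrightarrow> y \<in> carrier E \<Longrightarrow> y \<in> F"
  unfolding meet_filter_def by blast

lemma filter_mult: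
  assumes "meet_filter E F" "x \<in> F" "y \<in> F"
  shows "x \<cdot> y \<in> F"
proof -
  have "x \<sqinter> y \<in> F" using assms unfolding meet_filter_def by blast
  then show ?thesis using assms filter_closed meet_eq_mult by metis
qed

lemma filter_zero: "meet_filter E F \<Longrightarrow> \<zero> \<notin> F"
  unfolding meet_filter_def by blast

lemma filterI:
  assumes "F \<subseteq> carrier E" "F \<noteq> {}" "\<zero> \<notin> F"
    and "\<And>x y. x \<in> F \<Longrightarrow> y \<in> carrier E \<Longrightarrow> x \<sqsubseteq> y \<Longrightarrow> y \<in> F"
    and "\<And>x y. x \<in> F \<Longrightarrow> y \<in> F \<Longrightarrow> x \<cdot> y \<in> F"
  shows "meet_filter E F"
proof -
  have "x \<sqinter> y \<in> F" if "x \<in> F" "y \<in> F" for x y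
  proof -
    have "x \<in> carrier E" "y \<in> carrier E" using that assms(1) by blast+
    then show ?thesis using that assms(5) meet_eq_mult by metis
  qed
  then show ?thesis unfolding meet_filter_def using assms by blast
qed

text \<open>The filter generated by \<open>F\<close> and \<open>a\<close>, provided it omits
  \<open>\<zero>\<close>. Products with a single \<open>f\<close> suffice because \<open>F\<close>
  is closed under meets.\<close>

definition filter_extension :: "'a set \<Rightarrow> 'a \<Rightarrow> 'a set" where
  "filter_extension F a = {z \<in> carrier E. \<exists>f\<in>F. f \<cdot> a \<sqsubseteq> z}"

lemma
  assumes F: "meet_filter E F" and a: "a \<in> carrier E"
  shows subset_filter_extension: "F \<subseteq> filter_extension F a"
    and mem_filter_extension: "a \<in> filter_extension F a"
    and meet_filter_extension: "\<zero> \<notin> filter_extension F a \<Longrightarrow> meet_filter E (filter_extension F a)"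
proof -
  show sub: "F \<subseteq> filter_extension F a"
  proof
    fix x assume x: "x \<in> F"
    then have "x \<in> carrier E" using F filter_closed by blast
    then show "x \<in> filter_extension F a"
      unfolding filter_extension_def using x a mult_le(1) by blast
  qed
  obtain f where f: "f \<in> F" using F unfolding meet_filter_def by blast
  then have "f \<in> carrier E" using F filter_closed by blast
  then show "a \<in> filter_extension F a"
    unfolding filter_extension_def using f a mult_le(2) by blast
  assume nz: "\<zero> \<notin> filter_extension F a"
  show "meet_filter E (filter_extension F a)"
  proof (rule filterI)
    fix x y assume "x \<in> filter_extension F a" "y \<in> carrier E" "x \<sqsubseteq> y"
    then show "y \<in> filter_extension F a"
      unfolding filter_extension_def using le_trans by blast
  next
    fix x y assume "x \<in> filter_extension F a" "y \<in> filter_extension F a"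
    then obtain f g where fg: "f \<in> F" "f \<cdot> a \<sqsubseteq> x" "g \<in> F" "g \<cdot> a \<sqsubseteq> y" "x \<in> carrier E" "y \<in> carrier E"
      unfolding filter_extension_def by blast
    have cl: "f \<in> carrier E" "g \<in> carrier E" using fg F filter_closed by blast+
    have "(f \<cdot> a) \<cdot> (g \<cdot> a) \<sqsubseteq> x \<cdot> y" using fg by (intro le_mult)
    moreover have "(f \<cdot> a) \<cdot> (g \<cdot> a) = (f \<cdot> g) \<cdot> a"
      using cl a idem_left_commute[of a g a] by (simp add: mult_assoc)
    moreover have "f \<cdot> g \<in> F" using F fg filter_mult by blast
    ultimately show "x \<cdot> y \<in> filter_extension F a"
      unfolding filter_extension_def using fg mult_closed by auto
  qed (use sub f nz in \<open>auto simp: filter_extension_def\<close>)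
qed

lemma relative_complementsE:
  assumes "relative_complements E" "a \<in> carrier E" "b \<in> carrier E"
  obtains C where "finite C" "C \<subseteq> carrier E" "\<forall>c\<in>C. a \<cdot> c = \<zero>" "arrow E b (insert a C)"
proof -
  have "\<forall>a\<in>carrier E. \<forall>b\<in>carrier E. \<exists>C. finite C \<and> C \<subseteq> carrier E \<and> (\<forall>c\<in>C. a \<cdot> c = \<zero>) \<and>
      arrow E b (insert a C)"
    using assms(1) unfolding relative_complements_def idempotents_eq .
  from bspec[OF bspec[OF this assms(2)] assms(3)] show ?thesis using that by blast
qed

lemma tight_imp_ultrafilter:
  assumes rc: "relative_complements E" and F: "tight_filter E F"
  shows "meet_ultrafilter E F"
proof -
  have filter: "meet_filter E F" using F by (simp add: tight_filter_def)
  have "g \<in> F" if G: "meet_filter E G" "F \<subseteq> G" "g \<in> G" for G g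
  proof -
    obtain b where b: "b \<in> F" using filter unfolding meet_filter_def by blast
    have cl: "b \<in> carrier E" "g \<in> carrier E" using filter_closed[OF filter b] filter_closed[OF G(1,3)] .
    obtain C where C: "finite C" "C \<subseteq> carrier E" "\<forall>c\<in>C. g \<cdot> c = \<zero>" "arrow E b (insert g C)"
      using relative_complementsE[OF rc cl(2,1)] by blast
    have ins: "insert g C \<subseteq> carrier E" using C cl by blast
    \<comment> \<open>Multiplication by \<open>b\<close> moves the covering set below
      \<open>b\<close>, as \<open>finite_cover_of\<close> demands; upward closure of
      \<open>F\<close> recovers the factor \<open>c\<close> afterwards.\<close>
    define A where "A = (\<lambda>c. b \<cdot> c) ` insert g C"
    have "arrow E (b \<cdot> b) A"
      unfolding A_def using C(4) cl ins by (intro arrow_mult_left)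
    then have "arrow E b A" using cl by simp
    moreover have "A \<subseteq> down E {b}"
    proof
      fix z assume "z \<in> A"
      then obtain c where "c \<in> insert g C" "z = b \<cdot> c" unfolding A_def by blast
      then show "z \<in> down E {b}" using ins cl mult_le(1)[of b c] by (auto simp: mem_down)
    qed
    moreover have "finite A" using C by (simp add: A_def)
    ultimately have "finite_cover_of E A b" by (simp add: finite_cover_of_def)
    then obtain c where c: "c \<in> insert g C" "b \<cdot> c \<in> F"
      using F b unfolding tight_filter_def A_def by blast
    have "c \<in> carrier E" using c ins by blast
    then have cF: "c \<in> F" using filter_up[OF filter c(2)] mult_le(2)[OF cl(1)] by blast
    have "c \<notin> C"
    proof
      assume "c \<in> C"
      then have "g \<cdot> c = \<zero>" using C by blast
      moreover have "g \<cdot> c \<in> G" using G cF by (intro filter_mult) auto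
      ultimately show False using G filter_zero by metis
    qed
    then show "g \<in> F" using c cF by blast
  qed
  then show ?thesis using filter unfolding meet_ultrafilter_def by blast
qed

text \<open>A filter that is maximal among those avoiding this ideal is tight and does not contain \<open>a\<close>,
  although each of its members meets \<open>a\<close>.\<close>
definition covered_ideal :: "'a \<Rightarrow> 'a set" where
  "covered_ideal a = {x \<in> carrier E.
     \<exists>C. finite C \<and> C \<subseteq> carrier E \<and> (\<forall>c\<in>C. a \<cdot> c = \<zero>) \<and> arrow E x (insert a C)}"

lemma covered_ideal_closed: "x \<in> covered_ideal a \<Longrightarrow> x \<in> carrier E"
  by (simp add: covered_ideal_def)

text \<open>The finite sets belonging to the members of \<open>X\<close> are united into one, still
  orthogonal to \<open>a\<close>. Absorbing finitely covered elements is the property that makes a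
  maximal avoiding filter tight.\<close>

lemma covered_ideal_arrow:
  assumes "a \<in> carrier E" "x \<in> carrier E" "finite X" "X \<subseteq> covered_ideal a" "arrow E x X"
  shows "x \<in> covered_ideal a"
proof -
  have "\<forall>y\<in>X. \<exists>C. finite C \<and> C \<subseteq> carrier E \<and> (\<forall>c\<in>C. a \<cdot> c = \<zero>) \<and> arrow E y (insert a C)"
    using assms(4) unfolding covered_ideal_def by blast
  from bchoice[OF this] obtain C where C: "\<forall>y\<in>X. finite (C y) \<and> C y \<subseteq> carrier E \<and>
      (\<forall>c\<in>C y. a \<cdot> c = \<zero>) \<and> arrow E y (insert a (C y))" ..
  define D where "D = \<Union>(C ` X)"
  have D: "finite D" "D \<subseteq> carrier E" "\<forall>c\<in>D. a \<cdot> c = \<zero>"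
    unfolding D_def using C assms(3) by blast+
  have "arrow E y (insert a D)" if "y \<in> X" for y
    using C that by (rule_tac arrow_mono[of y "insert a (C y)"]) (auto simp: D_def)
  then have "set_arrow E X (insert a D)" by (simp add: set_arrow_def)
  moreover have "X \<subseteq> carrier E" using assms(4) covered_ideal_closed by blast
  ultimately have "arrow E x (insert a D)"
    using assms D by (intro arrow_trans[OF assms(5)]) auto
  then show ?thesis unfolding covered_ideal_def using D assms(2) by blast
qed

lemma covered_ideal_le:
  assumes "a \<in> carrier E" "y \<in> covered_ideal a" "x \<sqsubseteq> y"
  shows "x \<in> covered_ideal a"
proof (rule covered_ideal_arrow[of _ _ "{y}"])
  have y: "y \<in> carrier E" using assms covered_ideal_closed by blast
  then show "x \<in> carrier E" using assms le_closed by blast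
  show "arrow E x {y}" using assms y by (intro arrow_of_le[of x y]) auto
qed (use assms in auto)

lemma covered_ideal_self: "a \<in> carrier E \<Longrightarrow> a \<in> covered_ideal a"
  unfolding covered_ideal_def using arrow_mem[of a "{a}"] by (auto intro!: exI[of _ "{}"])

lemma covered_ideal_orthogonal:
  assumes "a \<in> carrier E" "x \<in> carrier E" "a \<cdot> x = \<zero>"
  shows "x \<in> covered_ideal a"
  unfolding covered_ideal_def using assms arrow_mem[of x "{a, x}"] by (auto intro!: exI[of _ "{x}"])

text \<open>If \<open>M\<close> missed every member of a cover of \<open>x\<close>, adjoining any
  \<open>y\<close> of the cover would reach the ideal, giving \<open>f y\<close> in it for some
  \<open>f \<in> M\<close>. One \<open>f\<close> below \<open>x\<close> works for all
  \<open>y\<close>; it is covered by the \<open>f y\<close> and so falls into the ideal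
  itself.\<close>

lemma maximal_filter_tight:
  assumes a: "a \<in> carrier E" and M: "meet_filter E M" "M \<inter> covered_ideal a = {}"
    and max: "\<And>G. meet_filter E G \<Longrightarrow> M \<subseteq> G \<Longrightarrow> G \<inter> covered_ideal a = {} \<Longrightarrow> G = M"
  shows "tight_filter E M"
proof -
  have "\<exists>y\<in>X. y \<in> M" if x: "x \<in> M" and X: "finite_cover_of E X x" for x X
  proof (rule ccontr)
    assume no: "\<not> (\<exists>y\<in>X. y \<in> M)"
    have xc: "x \<in> carrier E" using M x filter_closed by blast
    have fin: "finite X" and Xc: "X \<subseteq> carrier E" and arr: "arrow E x X"
      using X by (auto simp: finite_cover_of_def mem_down)
    have ex: "\<exists>f\<in>M. f \<cdot> y \<in> covered_ideal a" if y: "y \<in> X" for y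
    proof -
      have yc: "y \<in> carrier E" using y Xc by blast
      have "filter_extension M y \<inter> covered_ideal a \<noteq> {}"
      proof
        assume disj: "filter_extension M y \<inter> covered_ideal a = {}"
        \<comment> \<open>As \<open>\<zero>\<close> belongs to the ideal, an extension avoiding the
          ideal omits \<open>\<zero>\<close> and is a filter to which maximality applies.\<close>
        moreover have "\<zero> \<in> covered_ideal a" using a by (intro covered_ideal_orthogonal) auto
        ultimately have "meet_filter E (filter_extension M y)"
          using meet_filter_extension[OF M(1) yc] by blast
        then have "filter_extension M y = M"
          using max subset_filter_extension[OF M(1) yc] disj by blast
        then show False using mem_filter_extension[OF M(1) yc] no y by blast
      qed
      then obtain z f where "z \<in> covered_ideal a" "f \<in> M" "f \<cdot> y \<sqsubseteq> z"
        unfolding filter_extension_def by blast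
      then show ?thesis using covered_ideal_le[OF a] by blast
    qed
    \<comment> \<open>Finiteness of the cover is used here: the witnesses for the single
      \<open>y\<close> are multiplied together, starting from \<open>x\<close>.\<close>
    have "\<exists>f\<in>M. f \<sqsubseteq> x \<and> (\<forall>y\<in>X'. f \<cdot> y \<in> covered_ideal a)" if "finite X'" "X' \<subseteq> X" for X'
      using that
    proof (induction X' rule: finite_induct)
      case empty
      then show ?case using x xc le_refl by blast
    next
      case (insert y X')
      then obtain f where f: "f \<in> M" "f \<sqsubseteq> x" "\<forall>y\<in>X'. f \<cdot> y \<in> covered_ideal a" by blast
      obtain g where g: "g \<in> M" "g \<cdot> y \<in> covered_ideal a" using ex insert.prems by blast
      have cl: "f \<in> carrier E" "g \<in> carrier E" using f g M filter_closed by blast+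
      have "(f \<cdot> g) \<cdot> z \<in> covered_ideal a" if z: "z \<in> insert y X'" for z
      proof -
        have zc: "z \<in> carrier E" using z insert.prems Xc by blast
        have "(f \<cdot> g) \<cdot> z \<sqsubseteq> f \<cdot> z" "(f \<cdot> g) \<cdot> z \<sqsubseteq> g \<cdot> z"
          using cl zc by (auto intro!: le_mult mult_le)
        then show ?thesis using z f(3) g(2) covered_ideal_le[OF a] by blast
      qed
      moreover have "f \<cdot> g \<in> M" using f g M filter_mult by blast
      moreover have "f \<cdot> g \<sqsubseteq> x" using mult_le(1)[OF cl] f(2) xc le_trans by blast
      ultimately show ?case by blast
    qed
    from this[OF fin subset_refl]
    obtain f where f: "f \<in> M" "f \<sqsubseteq> x" "\<forall>y\<in>X. f \<cdot> y \<in> covered_ideal a" by blast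
    have fc: "f \<in> carrier E" using f M filter_closed by blast
    have "arrow E (f \<cdot> f) ((\<lambda>y. f \<cdot> y) ` X)"
      using arrow_le_trans[OF arr f(2) xc Xc] fc Xc by (intro arrow_mult_left)
    then have "arrow E f ((\<lambda>y. f \<cdot> y) ` X)" using fc by simp
    then have "f \<in> covered_ideal a"
      using f(3) fin fc a by (intro covered_ideal_arrow[of a f "(\<lambda>y. f \<cdot> y) ` X"]) auto
    then show False using f M by blast
  qed
  then show ?thesis using M unfolding tight_filter_def by blast
qed

lemma tight_ultrafilters_imp_relative_complements:
  assumes ultra: "\<And>F. tight_filter E F \<Longrightarrow> meet_ultrafilter E F"
  shows "relative_complements E"
proof (rule ccontr)
  assume "\<not> relative_complements E"
  then obtain a b where a: "a \<in> carrier E" and b: "b \<in> carrier E" and bI: "b \<notin> covered_ideal a"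
    unfolding relative_complements_def idempotents_eq covered_ideal_def by blast
  define \<F> where "\<F> = {F. meet_filter E F \<and> b \<in> F \<and> F \<inter> covered_ideal a = {}}"
  \<comment> \<open>The principal filter of \<open>b\<close> starts the Zorn argument; it avoids the
    ideal because the ideal is downward closed and omits \<open>b\<close>.\<close>
  have "{y \<in> carrier E. b \<sqsubseteq> y} \<in> \<F>"
  proof -
    have "meet_filter E {y \<in> carrier E. b \<sqsubseteq> y}"
    proof (rule filterI)
      have "b \<noteq> \<zero>" using bI a b covered_ideal_orthogonal by auto
      then show "\<zero> \<notin> {y \<in> carrier E. b \<sqsubseteq> y}" by simp
    next
      fix x y assume "x \<in> {y \<in> carrier E. b \<sqsubseteq> y}" "y \<in> {y \<in> carrier E. b \<sqsubseteq> y}"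
      then show "x \<cdot> y \<in> {y \<in> carrier E. b \<sqsubseteq> y}" using idem_le_mult by auto
    qed (use b le_trans le_refl in blast)+
    then show ?thesis unfolding \<F>_def using b bI le_refl covered_ideal_le[OF a] by blast
  qed
  then have "\<F> \<noteq> {}" by blast
  moreover have "\<Union>\<C> \<in> \<F>" if "\<C> \<noteq> {}" and chain: "subset.chain \<F> \<C>" for \<C>
  proof -
    have C: "\<And>F. F \<in> \<C> \<Longrightarrow> meet_filter E F \<and> b \<in> F \<and> F \<inter> covered_ideal a = {}"
      using chain unfolding subset.chain_def \<F>_def by blast
    have "meet_filter E (\<Union>\<C>)"
    proof (rule filterI)
      fix x y assume "x \<in> \<Union>\<C>" "y \<in> \<Union>\<C>"
      then obtain F G where FG: "F \<in> \<C>" "G \<in> \<C>" "x \<in> F" "y \<in> G" by blast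
      then have "F \<subseteq> G \<or> G \<subseteq> F" using chain unfolding subset.chain_def by blast
      then obtain H where "H \<in> \<C>" "x \<in> H" "y \<in> H" using FG by blast
      then show "x \<cdot> y \<in> \<Union>\<C>" using C filter_mult by blast
    next
      show "\<Union>\<C> \<subseteq> carrier E" using C filter_closed by blast
      show "\<Union>\<C> \<noteq> {}" using C \<open>\<C> \<noteq> {}\<close> by blast
      show "\<zero> \<notin> \<Union>\<C>" using C filter_zero by blast
    next
      fix x y assume "x \<in> \<Union>\<C>" "y \<in> carrier E" "x \<sqsubseteq> y"
      then show "y \<in> \<Union>\<C>" using C filter_up by blast
    qed
    then show ?thesis unfolding \<F>_def using C \<open>\<C> \<noteq> {}\<close> by blast
  qed
  ultimately have "\<exists>M\<in>\<F>. \<forall>X\<in>\<F>. M \<subseteq> X \<longrightarrow> X = M" by (rule subset_Zorn_nonempty)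
  then obtain M where "M \<in> \<F>" and max: "\<forall>X\<in>\<F>. M \<subseteq> X \<longrightarrow> X = M" by blast
  then have M: "meet_filter E M" "b \<in> M" "M \<inter> covered_ideal a = {}" by (auto simp: \<F>_def)
  have "tight_filter E M"
    using max M(2) by (intro maximal_filter_tight[OF a M(1,3)]) (auto simp: \<F>_def)
  then have "meet_ultrafilter E M" by (rule ultra)
  \<comment> \<open>A member of \<open>M\<close> orthogonal to \<open>a\<close> would lie in the
    ideal, so adjoining \<open>a\<close> yields a filter. The ultrafilter property then forces
    \<open>a \<in> M\<close>, although \<open>a\<close> itself is in the ideal.\<close>
  moreover have "\<zero> \<notin> filter_extension M a"
  proof
    assume "\<zero> \<in> filter_extension M a"
    then obtain f where f: "f \<in> M" "f \<cdot> a = \<zero>" by (auto simp: filter_extension_def)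
    then have fc: "f \<in> carrier E" using M(1) filter_closed by blast
    then have "f \<in> covered_ideal a"
      using f a mult_commute[of f a] by (intro covered_ideal_orthogonal) auto
    then show False using f M(3) by blast
  qed
  then have "meet_filter E (filter_extension M a)" by (rule meet_filter_extension[OF M(1) a])
  ultimately have "filter_extension M a = M"
    using subset_filter_extension[OF M(1) a] unfolding meet_ultrafilter_def by blast
  then show False
    using mem_filter_extension[OF M(1) a] covered_ideal_self[OF a] M(3) by blast
qed

lemma relative_complements_iff_tight:
  "relative_complements E \<longleftrightarrow> (\<forall>F. tight_filter E F \<longrightarrow> meet_ultrafilter E F)"
  using tight_imp_ultrafilter tight_ultrafilters_imp_relative_complements by blast

text \<open>For \<open>u\<close> below \<open>b\<close>, orthogonality to \<open>a\<close> and to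
  \<open>b \<cdot> a\<close> amount to the same. So complements of \<open>a\<close> in
  \<open>b\<close> can be sought for an element below \<open>b\<close>, as trapping does.\<close>

lemma relative_complements_iff_trapping: "relative_complements E \<longleftrightarrow> trapping E"
proof
  assume rc: "relative_complements E"
  show "trapping E"
    unfolding trapping_def
  proof (intro ballI impI)
    fix x y assume x: "x \<in> carrier E" and y: "y \<in> carrier E" "y \<noteq> \<zero> \<and> y \<sqsubseteq> x \<and> y \<noteq> x"
    obtain C where C: "finite C" "C \<subseteq> carrier E" "\<forall>c\<in>C. y \<cdot> c = \<zero>" "arrow E x (insert y C)"
      using relative_complementsE[OF rc y(1) x] by blast
    \<comment> \<open>Multiplication by \<open>x\<close> moves the complement below
      \<open>x\<close>; for \<open>u \<sqsubseteq> x\<close> the products of \<open>u\<close> with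
      \<open>c\<close> and with \<open>x \<cdot> c\<close> agree, so nothing is lost in
      covering.\<close>
    define Z where "Z = (\<lambda>c. x \<cdot> c) ` C"
    have "z \<in> down E {x} \<inter> perp E y" if z: "z \<in> Z" for z
    proof -
      obtain c where c: "c \<in> C" "c \<in> carrier E" "z = x \<cdot> c" using z C unfolding Z_def by blast
      have "z \<cdot> y = x \<cdot> (y \<cdot> c)" using c x y mult_commute[of c y] by (simp add: mult_assoc)
      then have "z \<cdot> y = \<zero>" using c C x by simp
      then show ?thesis
        using c x y mult_le(1)[of x c] by (simp add: mem_down perp_def meet_eq_mult)
    qed
    moreover have "\<exists>z\<in>Z. u \<sqinter> z \<noteq> \<zero>" if u: "u \<in> down E {x} \<inter> perp E y" "u \<noteq> \<zero>" for u
    proof -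
      have uc: "u \<in> carrier E" "u \<sqsubseteq> x" "u \<sqinter> y = \<zero>" using u by (auto simp: mem_down perp_def)
      then have "\<exists>c\<in>insert y C. u \<sqinter> c \<noteq> \<zero>" using C(4) u unfolding arrow_def by blast
      then obtain c where c: "c \<in> C" "u \<sqinter> c \<noteq> \<zero>" using uc by blast
      have cc: "c \<in> carrier E" using c C by blast
      have "u \<cdot> x = u" using uc x le_iff_left[of u x] by simp
      then have "u \<cdot> (x \<cdot> c) = u \<cdot> c" using uc x cc by (simp flip: mult_assoc)
      then have "u \<sqinter> (x \<cdot> c) \<noteq> \<zero>" using c cc uc x by (simp add: meet_eq_mult)
      then show ?thesis using c unfolding Z_def by blast
    qed
    ultimately have "finite Z \<and> cover_of_subset E Z (down E {x} \<inter> perp E y)"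
      using C(1) unfolding cover_of_subset_def Z_def by blast
    then show "\<exists>Z. finite Z \<and> cover_of_subset E Z (down E {x} \<inter> perp E y)" ..
  qed
next
  assume tr: "trapping E"
  show "relative_complements E"
    unfolding relative_complements_def idempotents_eq
  proof (intro ballI)
    fix a b assume a: "a \<in> carrier E" and b: "b \<in> carrier E"
    have ba: "b \<cdot> a \<in> carrier E" using a b by simp
    \<comment> \<open>Trapping speaks only of non-zero elements strictly below \<open>b\<close>. If
      \<open>b \<cdot> a\<close> is \<open>\<zero>\<close>, the complement is \<open>{b}\<close>; if
      it is \<open>b\<close>, the complement is empty.\<close>
    consider "b \<cdot> a = \<zero>" | "b \<cdot> a = b" | "b \<cdot> a \<noteq> \<zero>" "b \<cdot> a \<noteq> b" by blast
    then show "\<exists>C. finite C \<and> C \<subseteq> carrier E \<and> (\<forall>c\<in>C. a \<cdot> c = \<zero>) \<and> arrow E b (insert a C)"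
    proof cases
      case 1
      then have "arrow E b {a, b}" "a \<cdot> b = \<zero>" using a b arrow_mem mult_commute[of a b] by auto
      then show ?thesis using b by (intro exI[of _ "{b}"]) simp
    next
      case 2
      then have "b \<sqsubseteq> a" using mult_le(2)[OF b a] by simp
      then have "arrow E b {a}" using a by (intro arrow_of_le[of b a]) auto
      then show ?thesis by (intro exI[of _ "{}"]) simp
    next
      case 3
      then obtain Z where Z: "finite Z" "cover_of_subset E Z (down E {b} \<inter> perp E (b \<cdot> a))"
        using tr b ba mult_le(1)[OF b a] unfolding trapping_def by blast
      have Z': "z \<in> carrier E" "z \<sqsubseteq> b" "z \<sqinter> (b \<cdot> a) = \<zero>" if "z \<in> Z" for z
        using that Z unfolding cover_of_subset_def down_def perp_def by blast+
      have orth: "a \<cdot> z = \<zero>" if z: "z \<in> Z" for z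
      proof -
        have "z \<cdot> b = z" using Z'[OF z] b le_iff_left[of z b] by simp
        then have "z \<cdot> (b \<cdot> a) = z \<cdot> a" using Z'[OF z] a b by (simp flip: mult_assoc)
        then have "z \<cdot> a = \<zero>" using Z'[OF z] ba by (simp add: meet_eq_mult)
        then show ?thesis using Z'[OF z] a mult_commute by simp
      qed
      have "arrow E b (insert a Z)"
        unfolding arrow_def
      proof (intro ballI impI)
        fix u assume u: "u \<in> carrier E" "u \<sqsubseteq> b \<and> u \<noteq> \<zero>"
        show "\<exists>c\<in>insert a Z. u \<sqinter> c \<noteq> \<zero>"
        \<comment> \<open>Either \<open>u\<close> meets \<open>a\<close>, or it is orthogonal to
          \<open>b \<cdot> a\<close> as well and is caught by the finite cover
          \<open>Z\<close>.\<close>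
        proof (cases "u \<sqinter> a = \<zero>")
          case True
          have "u \<cdot> b = u" using u b le_iff_left[of u b] by simp
          then have "u \<cdot> (b \<cdot> a) = u \<cdot> a" using u a b by (simp flip: mult_assoc)
          then have "u \<sqinter> (b \<cdot> a) = \<zero>" using True u a ba by (simp add: meet_eq_mult)
          then have "u \<in> down E {b} \<inter> perp E (b \<cdot> a)" using u by (simp add: mem_down perp_def)
          then have "\<exists>z\<in>Z. u \<sqinter> z \<noteq> \<zero>" using Z(2) u unfolding cover_of_subset_def by blast
          then show ?thesis by blast
        qed blast
      qed
      then show ?thesis using Z(1) Z'(1) orth by (intro exI[of _ Z]) blast
    qed
  qed
qed

end

theorem mainTheorem3:
  shows "(\<forall>S :: 'a semigroup0. inverse_meet_semigroup S \<longrightarrow>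
            (pre_boolean S \<longleftrightarrow> pre_boolean (idempotent_semilattice S)))
       \<and> (\<forall>E :: 'b semigroup0. meet_semilattice0 E \<longrightarrow>
            (pre_boolean E \<longleftrightarrow> (\<forall>F. tight_filter E F \<longrightarrow> meet_ultrafilter E F)))
       \<and> (\<forall>E :: 'c semigroup0. meet_semilattice0 E \<and> zero_disjunctive E \<longrightarrow>
            (pre_boolean E \<longleftrightarrow> trapping E))"
proof (intro conjI allI impI)
  fix S :: "'a semigroup0" assume "inverse_meet_semigroup S"
  then interpret inverse_meet_semigroup S .
  interpret E: meet_semilattice0 "idempotent_semilattice S" by (rule meet_semilattice_semilattice)
  show "pre_boolean S \<longleftrightarrow> pre_boolean (idempotent_semilattice S)"
    unfolding pre_boolean_iff E.pre_boolean_iff relative_complements_semilattice ..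
next
  fix E :: "'b semigroup0" assume "meet_semilattice0 E"
  then interpret meet_semilattice0 E .
  show "pre_boolean E \<longleftrightarrow> (\<forall>F. tight_filter E F \<longrightarrow> meet_ultrafilter E F)"
    unfolding pre_boolean_iff by (rule relative_complements_iff_tight)
next
  fix E :: "'c semigroup0" assume "meet_semilattice0 E \<and> zero_disjunctive E"
  then interpret meet_semilattice0 E by simp
  show "pre_boolean E \<longleftrightarrow> trapping E"
    unfolding pre_boolean_iff by (rule relative_complements_iff_trapping)
qed

end
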